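(* Let $M$ be an inductively connected matroid of rank $n$ on $d$ points, and let $w=(p_1,\ldots,p_d)$ be an ordering of its points such that $\{p_1,\ldots,p_n\}$ is a basis and $|(\mathcal{L}_w[i])_{p_i}|\leq 2$ for all $n<i\leq d$. Then $\Gamma_M$ is isomorphic to a Zariski open subset of $\mathbb{C}^m$ with $m=\sum_{i=1}^d\widetilde{\tau}_i$.
   Context: Subspaces of a matroid $K$ of rank $k$: circuits of size at most $k$ grouped by $C_1\sim C_2\iff\mathrm{cl}(C_1)=\mathrm{cl}(C_2)$; each class $l$ is a subspace, $\mathrm{rank}(l)$ the rank of its circuits, $l$ identified with the set of points lying in some circuit of the class. $M_w[i]$ is the restriction of $M$ to $\{p_1,\ldots,p_i\}$; $(\mathcal{L}_w[i])_{p_i}$ is the set of subspaces of $M_w[i]$ containing $p_i$. $\tau_i=\sum_{l\in(\mathcal{L}_w[i])_{p_i}}\mathrm{rank}(l)-n(|(\mathcal{L}_w[i])_{p_i}|-1)$; $\widetilde{\tau}_i=\tau_i$ if $|(\mathcal{L}_w[i])_{p_i}|\leq 1$, and $\widetilde{\tau}_i=\mathrm{rank}(l_1)+\mathrm{rank}(l_2)-\mathrm{rank}(l_1\cup l_2)$ if $(\mathcal{L}_w[i])_{p_i}=\{l_1,l_2\}$. $M$ is inductively connected if such an ordering exists. $\Gamma_M\subseteq\mathbb{C}^{nd}$ is the set of families $(\gamma_1,\ldots,\gamma_d)$ of vectors of $\mathbb{C}^n$ whose linearly dependent subfamilies are exactly those indexed by dependent sets of $M$. *)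

theory Defs
  imports Complex_Main "HOL-Library.FuncSet"
begin

section \<open>Matroids\<close>

record 'a matroid_data =
  ground :: "'a set"
  indep :: "'a set \<Rightarrow> bool"

definition matroid :: "'a matroid_data \<Rightarrow> bool" where
  "matroid M \<longleftrightarrow>
     finite (ground M) \<and>
     (\<forall>X. indep M X \<longrightarrow> X \<subseteq> ground M) \<and>
     indep M {} \<and>
     (\<forall>X Y. indep M X \<and> Y \<subseteq> X \<longrightarrow> indep M Y) \<and>
     (\<forall>X Y. indep M X \<and> indep M Y \<and> card Y < card X \<longrightarrow>
        (\<exists>x\<in>X - Y. indep M (insert x Y)))"

definition rank_of :: "'a matroid_data \<Rightarrow> 'a set \<Rightarrow> nat" where
  "rank_of M X = Max {card Y | Y. Y \<subseteq> X \<and> indep M Y}"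

definition matroid_rank :: "'a matroid_data \<Rightarrow> nat" where
  "matroid_rank M = rank_of M (ground M)"

definition basis :: "'a matroid_data \<Rightarrow> 'a set \<Rightarrow> bool" where
  "basis M B \<longleftrightarrow> indep M B \<and> (\<forall>X. indep M X \<and> B \<subseteq> X \<longrightarrow> X = B)"

definition dependent_set :: "'a matroid_data \<Rightarrow> 'a set \<Rightarrow> bool" where
  "dependent_set M X \<longleftrightarrow> X \<subseteq> ground M \<and> \<not> indep M X"

definition circuit :: "'a matroid_data \<Rightarrow> 'a set \<Rightarrow> bool" where
  "circuit M C \<longleftrightarrow> dependent_set M C \<and> (\<forall>X. X \<subset> C \<longrightarrow> \<not> dependent_set M X)"

definition cl :: "'a matroid_data \<Rightarrow> 'a set \<Rightarrow> 'a set" where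
  "cl M X = {x \<in> ground M. rank_of M (insert x X) = rank_of M X}"

definition restriction :: "'a matroid_data \<Rightarrow> 'a set \<Rightarrow> 'a matroid_data" where
  "restriction M S = \<lparr>ground = S, indep = (\<lambda>X. X \<subseteq> S \<and> indep M X)\<rparr>"


section \<open>Subspaces of a matroid\<close>

definition small_circuits :: "'a matroid_data \<Rightarrow> 'a set set" where
  "small_circuits K = {C. circuit K C \<and> card C \<le> matroid_rank K}"

definition same_closure :: "'a matroid_data \<Rightarrow> ('a set \<times> 'a set) set" where
  "same_closure K =
     {(C1, C2). C1 \<in> small_circuits K \<and> C2 \<in> small_circuits K \<and> cl K C1 = cl K C2}"

text \<open>A subspace is kept as a class of circuits; its set of points is the union of the class.\<close>

definition subspaces :: "'a matroid_data \<Rightarrow> 'a set set set" where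
  "subspaces K = small_circuits K // same_closure K"

definition points :: "'a set set \<Rightarrow> 'a set" where
  "points l = \<Union> l"

definition subspace_rank :: "'a matroid_data \<Rightarrow> 'a set set \<Rightarrow> nat" where
  "subspace_rank K l = (THE r. \<forall>C\<in>l. rank_of K C = r)"

definition subspaces_through :: "'a matroid_data \<Rightarrow> 'a \<Rightarrow> 'a set set set" where
  "subspaces_through K p = {l \<in> subspaces K. p \<in> points l}"


section \<open>Orderings and inductive connectedness\<close>

definition point_ordering :: "'a matroid_data \<Rightarrow> (nat \<Rightarrow> 'a) \<Rightarrow> bool" where
  "point_ordering M w \<longleftrightarrow> bij_betw w {1..card (ground M)} (ground M)"

definition initial :: "'a matroid_data \<Rightarrow> (nat \<Rightarrow> 'a) \<Rightarrow> nat \<Rightarrow> 'a matroid_data" where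
  "initial M w i = restriction M (w ` {1..i})"

definition new_subspaces :: "'a matroid_data \<Rightarrow> (nat \<Rightarrow> 'a) \<Rightarrow> nat \<Rightarrow> 'a set set set" where
  "new_subspaces M w i = subspaces_through (initial M w i) (w i)"

definition inductively_connected :: "'a matroid_data \<Rightarrow> bool" where
  "inductively_connected M \<longleftrightarrow>
     (\<exists>w. point_ordering M w \<and> basis M (w ` {1..matroid_rank M}) \<and>
          (\<forall>i. matroid_rank M < i \<and> i \<le> card (ground M) \<longrightarrow> card (new_subspaces M w i) \<le> 2))"

text \<open>With no subspaces the formula gives \<open>n\<close>, so the subtraction of one must not truncate.\<close>

definition tau :: "'a matroid_data \<Rightarrow> (nat \<Rightarrow> 'a) \<Rightarrow> nat \<Rightarrow> int" where
  "tau M w i =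
     (\<Sum>l\<in>new_subspaces M w i. int (subspace_rank (initial M w i) l))
       - int (matroid_rank M) * (int (card (new_subspaces M w i)) - 1)"

text \<open>The second branch is meant for exactly two subspaces \<open>l\<^sub>1, l\<^sub>2\<close>, where it reads
  \<open>rank l\<^sub>1 + rank l\<^sub>2 - rank (l\<^sub>1 \<union> l\<^sub>2)\<close>; it has no meaning for three or more.\<close>

definition tau_tilde :: "'a matroid_data \<Rightarrow> (nat \<Rightarrow> 'a) \<Rightarrow> nat \<Rightarrow> int" where
  "tau_tilde M w i =
     (if card (new_subspaces M w i) \<le> 1 then tau M w i
      else (\<Sum>l\<in>new_subspaces M w i. int (subspace_rank (initial M w i) l))
             - int (rank_of (initial M w i) (\<Union>l\<in>new_subspaces M w i. points l)))"


section \<open>Quasi-affine varieties over the complex numbers\<close>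

text \<open>Affine space with coordinates indexed by a finite set \<open>I\<close> is the set of functions
  that are extensional on \<open>I\<close>.\<close>

definition affine_space :: "'i set \<Rightarrow> ('i \<Rightarrow> complex) set" where
  "affine_space I = (I \<rightarrow>\<^sub>E UNIV)"

inductive_set poly_funs :: "'i set \<Rightarrow> (('i \<Rightarrow> complex) \<Rightarrow> complex) set" for I :: "'i set" where
  const: "(\<lambda>_. c) \<in> poly_funs I"
| coord: "i \<in> I \<Longrightarrow> (\<lambda>x. x i) \<in> poly_funs I"
| add: "f \<in> poly_funs I \<Longrightarrow> g \<in> poly_funs I \<Longrightarrow> (\<lambda>x. f x + g x) \<in> poly_funs I"
| mult: "f \<in> poly_funs I \<Longrightarrow> g \<in> poly_funs I \<Longrightarrow> (\<lambda>x. f x * g x) \<in> poly_funs I"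

definition zariski_closed :: "'i set \<Rightarrow> ('i \<Rightarrow> complex) set \<Rightarrow> bool" where
  "zariski_closed I Z \<longleftrightarrow>
     (\<exists>F \<subseteq> poly_funs I. Z = {x \<in> affine_space I. \<forall>f\<in>F. f x = 0})"

definition zariski_open :: "'i set \<Rightarrow> ('i \<Rightarrow> complex) set \<Rightarrow> bool" where
  "zariski_open I U \<longleftrightarrow> U \<subseteq> affine_space I \<and> zariski_closed I (affine_space I - U)"

definition regular_function ::
  "'i set \<Rightarrow> ('i \<Rightarrow> complex) set \<Rightarrow> (('i \<Rightarrow> complex) \<Rightarrow> complex) \<Rightarrow> bool" where
  "regular_function I X f \<longleftrightarrow>
     (\<forall>x\<in>X. \<exists>U. \<exists>g\<in>poly_funs I. \<exists>h\<in>poly_funs I.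
        zariski_open I U \<and> x \<in> U \<and> (\<forall>y\<in>X \<inter> U. h y \<noteq> 0 \<and> f y = g y / h y))"

definition regular_map ::
  "'i set \<Rightarrow> ('i \<Rightarrow> complex) set \<Rightarrow> 'j set \<Rightarrow> ('j \<Rightarrow> complex) set \<Rightarrow>
     (('i \<Rightarrow> complex) \<Rightarrow> ('j \<Rightarrow> complex)) \<Rightarrow> bool" where
  "regular_map I X J Y \<phi> \<longleftrightarrow>
     \<phi> ` X \<subseteq> Y \<and> (\<forall>j\<in>J. regular_function I X (\<lambda>x. \<phi> x j))"

definition isomorphic_varieties ::
  "'i set \<Rightarrow> ('i \<Rightarrow> complex) set \<Rightarrow> 'j set \<Rightarrow> ('j \<Rightarrow> complex) set \<Rightarrow> bool" where
  "isomorphic_varieties I X J Y \<longleftrightarrow>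
     (\<exists>\<phi> \<psi>. regular_map I X J Y \<phi> \<and> regular_map J Y I X \<psi> \<and>
            (\<forall>x\<in>X. \<psi> (\<phi> x) = x) \<and> (\<forall>y\<in>Y. \<phi> (\<psi> y) = y))"


section \<open>The realization space\<close>

text \<open>A family of vectors of \<open>\<complex>\<^sup>n\<close> indexed by points is stored as one function \<open>\<gamma>\<close> on pairs:
  \<open>\<gamma> (p, j)\<close> is the \<open>j\<close>-th coordinate of the vector at \<open>p\<close>.  Dependence is that of a
  family, so repeated vectors are dependent.\<close>

definition linearly_dependent_family ::
  "nat \<Rightarrow> ('a \<times> nat \<Rightarrow> complex) \<Rightarrow> 'a set \<Rightarrow> bool" where
  "linearly_dependent_family n \<gamma> S \<longleftrightarrow>
     (\<exists>c :: 'a \<Rightarrow> complex. (\<exists>p\<in>S. c p \<noteq> 0) \<and> (\<forall>j<n. (\<Sum>p\<in>S. c p * \<gamma> (p, j)) = 0))"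

definition realization_space :: "'a matroid_data \<Rightarrow> ('a \<times> nat \<Rightarrow> complex) set" where
  "realization_space M =
     {\<gamma> \<in> affine_space (ground M \<times> {..<matroid_rank M}).
        \<forall>S \<subseteq> ground M. linearly_dependent_family (matroid_rank M) \<gamma> S \<longleftrightarrow> dependent_set M S}"

end

theory Submission
  imports Defs "Jordan_Normal_Form.Determinant"
begin

text \<open>Add the points one at a time. Over a realization \<open>x\<close> of the first \<open>i - 1\<close> points, the vector of
  \<open>p\<^sub>i\<close> ranges over an open part of the intersection of the spans of \<open>A\<close> and \<open>B\<close>, where
  \<open>A \<union> {p\<^sub>i}\<close> and \<open>B \<union> {p\<^sub>i}\<close> are circuits representing the two subspaces through \<open>p\<^sub>i\<close>.
  This bundle of linear spaces is trivial: pick \<open>D \<subseteq> B - A\<close> such that \<open>A \<union> D\<close> is a basis of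
  \<open>A \<union> B\<close>; for \<open>b \<in> B - D\<close>, subtracting from \<open>x\<^sub>b\<close> its \<open>D\<close>-component with respect to
  \<open>A \<union> D\<close> gives a vector of the intersection, these vectors form a basis of it, and by Cramer's
  rule they are fractions in the entries of \<open>x\<close> with nowhere vanishing denominators.
  The rank of the bundle is \<open>card B - card D = rank A + rank B - rank (A \<union> B)\<close>.\<close>

section \<open>Globally fractional functions\<close>

text \<open>Dependence among old points does not change when \<open>p_i\<close> is added, so only
  sets through \<open>p_i\<close> matter, and dependence need only be checked on circuits. A circuit
  \<open>C\<close> through \<open>p_i\<close> with at most n points lies in one of the two classes,
  so over every realization the span of \<open>C - {p_i}\<close> contains that of \<open>A\<close>
  or of \<open>B\<close>. A larger circuit has n + 1 points, and its n old points already span C^n.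
  Hence two span conditions produce every dependence, while independence of the sets through
  \<open>p_i\<close> is the nonvanishing of finitely many determinants; this is where "open part"
  comes from. The bound two keeps the rank of the bundle constant: the dimension of the intersection
  of two spans is fixed by ranks in the matroid. For three spans the common intersection may vary in
  dimension with the realization, and the new point could impose a closed condition on the old ones.
  The set \<open>D\<close> and the bases used in Cramer's rule are chosen in the matroid alone, so
  one choice serves all realizations.\<close>

lemma poly_funs_sum:
  "(\<And>s. s \<in> S \<Longrightarrow> f s \<in> poly_funs I) \<Longrightarrow> (\<lambda>x. \<Sum>s\<in>S. f s x) \<in> poly_funs I"
  by (induction S rule: infinite_finite_induct) (auto intro: poly_funs.intros)

lemma poly_funs_prod:
  "(\<And>s. s \<in> S \<Longrightarrow> f s \<in> poly_funs I) \<Longrightarrow> (\<lambda>x. \<Prod>s\<in>S. f s x) \<in> poly_funs I"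
  by (induction S rule: infinite_finite_induct) (auto intro: poly_funs.intros)

lemma poly_funs_mono: "f \<in> poly_funs I \<Longrightarrow> I \<subseteq> J \<Longrightarrow> f \<in> poly_funs J"
  by (induction rule: poly_funs.induct) (auto intro: poly_funs.intros)

text \<open>All functions needed here are quotients with one denominator that works on the whole
  variety, which spares the local patching built into regularity.\<close>

definition fractional :: "'i set \<Rightarrow> ('i \<Rightarrow> complex) set \<Rightarrow> (('i \<Rightarrow> complex) \<Rightarrow> complex) \<Rightarrow> bool" where
  "fractional I X f \<longleftrightarrow>
     (\<exists>g\<in>poly_funs I. \<exists>h\<in>poly_funs I. \<forall>x\<in>X. h x \<noteq> 0 \<and> f x = g x / h x)"

lemma fractional_poly: "f \<in> poly_funs I \<Longrightarrow> fractional I X f"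
  unfolding fractional_def by (intro bexI[of _ f] bexI[OF _ poly_funs.const[of 1]]) auto

lemma fractional_cong:
  "(\<And>x. x \<in> X \<Longrightarrow> f x = g x) \<Longrightarrow> fractional I X f \<longleftrightarrow> fractional I X g"
  unfolding fractional_def by simp

lemma fractional_const: "fractional I X (\<lambda>_. c)"
  by (intro fractional_poly poly_funs.const)

lemma fractional_coord: "i \<in> I \<Longrightarrow> fractional I X (\<lambda>x. x i)"
  by (intro fractional_poly poly_funs.coord)

lemma fractional_add:
  assumes "fractional I X f" "fractional I X g"
  shows "fractional I X (\<lambda>x. f x + g x)"
proof -
  obtain a b where 1: "a \<in> poly_funs I" "b \<in> poly_funs I" "\<forall>x\<in>X. b x \<noteq> 0 \<and> f x = a x / b x"
    using assms(1) unfolding fractional_def by blast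
  obtain c d where 2: "c \<in> poly_funs I" "d \<in> poly_funs I" "\<forall>x\<in>X. d x \<noteq> 0 \<and> g x = c x / d x"
    using assms(2) unfolding fractional_def by blast
  have "(\<lambda>x. a x * d x + c x * b x) \<in> poly_funs I" "(\<lambda>x. b x * d x) \<in> poly_funs I"
    using 1 2 by (auto intro!: poly_funs.intros)
  moreover have "\<forall>x\<in>X. b x * d x \<noteq> 0 \<and> f x + g x = (a x * d x + c x * b x) / (b x * d x)"
    using 1 2 by (auto simp: add_frac_eq)
  ultimately show ?thesis
    unfolding fractional_def by (intro bexI)
qed

lemma fractional_mult:
  assumes "fractional I X f" "fractional I X g"
  shows "fractional I X (\<lambda>x. f x * g x)"
proof -
  obtain a b where 1: "a \<in> poly_funs I" "b \<in> poly_funs I" "\<forall>x\<in>X. b x \<noteq> 0 \<and> f x = a x / b x"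
    using assms(1) unfolding fractional_def by blast
  obtain c d where 2: "c \<in> poly_funs I" "d \<in> poly_funs I" "\<forall>x\<in>X. d x \<noteq> 0 \<and> g x = c x / d x"
    using assms(2) unfolding fractional_def by blast
  have "(\<lambda>x. a x * c x) \<in> poly_funs I" "(\<lambda>x. b x * d x) \<in> poly_funs I"
    using 1 2 by (auto intro!: poly_funs.intros)
  moreover have "\<forall>x\<in>X. b x * d x \<noteq> 0 \<and> f x * g x = (a x * c x) / (b x * d x)"
    using 1 2 by auto
  ultimately show ?thesis
    unfolding fractional_def by (intro bexI)
qed

lemma fractional_inverse:
  assumes "fractional I X f" "\<And>x. x \<in> X \<Longrightarrow> f x \<noteq> 0"
  shows "fractional I X (\<lambda>x. inverse (f x))"
proof -
  obtain a b where "a \<in> poly_funs I" "b \<in> poly_funs I" "\<forall>x\<in>X. b x \<noteq> 0 \<and> f x = a x / b x"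
    using assms(1) unfolding fractional_def by blast
  moreover from this have "\<forall>x\<in>X. a x \<noteq> 0 \<and> inverse (f x) = b x / a x"
    using assms(2) by fastforce
  ultimately show ?thesis
    unfolding fractional_def by blast
qed

lemma fractional_divide:
  assumes "fractional I X f" "fractional I X g" "\<And>x. x \<in> X \<Longrightarrow> g x \<noteq> 0"
  shows "fractional I X (\<lambda>x. f x / g x)"
  unfolding divide_inverse by (intro fractional_mult fractional_inverse assms)

lemma fractional_diff:
  assumes "fractional I X f" "fractional I X g"
  shows "fractional I X (\<lambda>x. f x - g x)"
proof -
  have "fractional I X (\<lambda>x. f x + (-1) * g x)"
    by (intro fractional_add fractional_mult fractional_const assms)
  then show ?thesis by simp
qed

lemma fractional_sum:
  "(\<And>s. s \<in> S \<Longrightarrow> fractional I X (f s)) \<Longrightarrow> fractional I X (\<lambda>x. \<Sum>s\<in>S. f s x)"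
  by (induction S rule: infinite_finite_induct) (auto intro: fractional_const fractional_add)

lemma fractional_poly_comp:
  assumes "f \<in> poly_funs I" "\<And>i. i \<in> I \<Longrightarrow> fractional J Z (\<lambda>z. F z i)"
  shows "fractional J Z (\<lambda>z. f (F z))"
  using assms(1)
  by induction (auto intro: fractional_const fractional_add fractional_mult assms(2))

lemma fractional_comp:
  assumes "fractional I X f" "F ` Z \<subseteq> X" "\<And>i. i \<in> I \<Longrightarrow> fractional J Z (\<lambda>z. F z i)"
  shows "fractional J Z (\<lambda>z. f (F z))"
proof -
  obtain g h where gh: "g \<in> poly_funs I" "h \<in> poly_funs I" "\<forall>x\<in>X. h x \<noteq> 0 \<and> f x = g x / h x"
    using assms(1) unfolding fractional_def by blast
  have "fractional J Z (\<lambda>z. g (F z) / h (F z))"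
  proof (rule fractional_divide)
    show "fractional J Z (\<lambda>z. g (F z))" "fractional J Z (\<lambda>z. h (F z))"
      by (rule fractional_poly_comp[OF _ assms(3)], fact, assumption)+
    show "h (F z) \<noteq> 0" if "z \<in> Z" for z
      using gh(3) assms(2) that by blast
  qed
  then show ?thesis
    using gh assms(2) by (subst fractional_cong[where g = "\<lambda>z. g (F z) / h (F z)"]) auto
qed

lemma fractional_subset: "fractional I X f \<Longrightarrow> Y \<subseteq> X \<Longrightarrow> fractional I Y f"
  unfolding fractional_def by blast

section \<open>Zariski open sets: principal open subsets and cylinders\<close>

lemma zariski_open_affine_space: "zariski_open I (affine_space I)"
proof -
  have "{} = {x \<in> affine_space I. \<forall>f\<in>{\<lambda>_. 1 :: complex}. f x = 0}"
    and "{\<lambda>_. 1 :: complex} \<subseteq> poly_funs I"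
    by (auto intro: poly_funs.const)
  then show ?thesis
    unfolding zariski_open_def zariski_closed_def Diff_cancel by blast
qed

text \<open>Multiplying each equation of the complement of \<open>W\<close> by \<open>g\<close> adds
  the zero set of \<open>g\<close> to that complement.\<close>

lemma zariski_open_inter_nonvanishing:
  assumes "zariski_open I W" "g \<in> poly_funs I"
  shows "zariski_open I {x \<in> W. g x \<noteq> 0}"
proof -
  obtain F where F: "F \<subseteq> poly_funs I" "affine_space I - W = {x \<in> affine_space I. \<forall>f\<in>F. f x = 0}"
    and W: "W \<subseteq> affine_space I"
    using assms(1) unfolding zariski_open_def zariski_closed_def by blast
  let ?F = "(\<lambda>f x. f x * g x) ` F"
  have "?F \<subseteq> poly_funs I"
    using F(1) assms(2) by (auto intro: poly_funs.mult)
  moreover have "affine_space I - {x \<in> W. g x \<noteq> 0} = {x \<in> affine_space I. \<forall>f\<in>?F. f x = 0}"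
    using F(2) W by auto
  ultimately show ?thesis
    unfolding zariski_open_def zariski_closed_def using W by blast
qed

text \<open>A polynomial in the coordinates \<open>I\<close> takes the same value at
  \<open>y\<close> and at \<open>restrict y I\<close>, so the equations of the complement of
  \<open>U\<close> also describe the complement of the cylinder.\<close>

lemma zariski_open_cylinder:
  fixes I J :: "'i set"
  assumes "zariski_open I U" "I \<subseteq> J"
  shows "zariski_open J {y \<in> affine_space J. restrict y I \<in> U}"
proof -
  obtain F where F: "F \<subseteq> poly_funs I" "affine_space I - U = {x \<in> affine_space I. \<forall>f\<in>F. f x = 0}"
    and U: "U \<subseteq> affine_space I"
    using assms(1) unfolding zariski_open_def zariski_closed_def by blast
  have restr: "f (restrict y I) = f y" if "f \<in> poly_funs I" for f y
    using that by induction auto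
  have "restrict y I \<in> affine_space I" for y :: "'i \<Rightarrow> complex"
    by (simp add: affine_space_def)
  then have "restrict y I \<notin> U \<longleftrightarrow> (\<forall>f\<in>F. f y = 0)" for y :: "'i \<Rightarrow> complex"
  proof -
    have "restrict y I \<notin> U \<longleftrightarrow> (\<forall>f\<in>F. f (restrict y I) = 0)"
      using F(2) \<open>restrict y I \<in> affine_space I\<close> by blast
    also have "\<dots> \<longleftrightarrow> (\<forall>f\<in>F. f y = 0)"
    proof (intro ball_cong refl)
      fix f assume "f \<in> F"
      then show "f (restrict y I) = 0 \<longleftrightarrow> f y = 0"
        using restr[of f y] F(1) by auto
    qed
    finally show ?thesis .
  qed
  then have "affine_space J - {y \<in> affine_space J. restrict y I \<in> U}
      = {x \<in> affine_space J. \<forall>f\<in>F. f x = 0}"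
    by blast
  moreover have "F \<subseteq> poly_funs J"
    using F(1) poly_funs_mono[OF _ assms(2)] by blast
  ultimately show ?thesis
    unfolding zariski_open_def zariski_closed_def by blast
qed

section \<open>Isomorphisms given by global fractions\<close>

text \<open>A stronger form of \<open>isomorphic_varieties\<close> that serves as the induction
  invariant: global fractions compose by substitution. It is weakened to regularity only at the very
  end.\<close>

definition fractional_iso ::
  "'i set \<Rightarrow> ('i \<Rightarrow> complex) set \<Rightarrow> 'j set \<Rightarrow> ('j \<Rightarrow> complex) set \<Rightarrow> bool" where
  "fractional_iso I X J Y \<longleftrightarrow>
     (\<exists>\<phi> \<psi>. \<phi> ` X \<subseteq> Y \<and> \<psi> ` Y \<subseteq> X \<and>
        (\<forall>j\<in>J. fractional I X (\<lambda>x. \<phi> x j)) \<and> (\<forall>i\<in>I. fractional J Y (\<lambda>y. \<psi> y i)) \<and>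
        (\<forall>x\<in>X. \<psi> (\<phi> x) = x) \<and> (\<forall>y\<in>Y. \<phi> (\<psi> y) = y))"

lemma fractional_imp_regular:
  assumes "fractional I X f" "X \<subseteq> affine_space I"
  shows "regular_function I X f"
proof -
  obtain g h where "g \<in> poly_funs I" "h \<in> poly_funs I" "\<forall>x\<in>X. h x \<noteq> 0 \<and> f x = g x / h x"
    using assms(1) unfolding fractional_def by blast
  then show ?thesis
    using assms(2) zariski_open_affine_space[of I] unfolding regular_function_def by blast
qed

lemma fractional_iso_imp_isomorphic:
  assumes "fractional_iso I X J Y" "X \<subseteq> affine_space I" "Y \<subseteq> affine_space J"
  shows "isomorphic_varieties I X J Y"
proof -
  obtain \<phi> \<psi> where "\<phi> ` X \<subseteq> Y" "\<psi> ` Y \<subseteq> X"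
    "\<forall>j\<in>J. fractional I X (\<lambda>x. \<phi> x j)" "\<forall>i\<in>I. fractional J Y (\<lambda>y. \<psi> y i)"
    "\<forall>x\<in>X. \<psi> (\<phi> x) = x" "\<forall>y\<in>Y. \<phi> (\<psi> y) = y"
    using assms(1) unfolding fractional_iso_def by blast
  then show ?thesis
    unfolding isomorphic_varieties_def regular_map_def
    by (intro exI[of _ \<phi>] exI[of _ \<psi>]) (auto intro!: fractional_imp_regular[OF _ assms(2)] fractional_imp_regular[OF _ assms(3)])
qed

text \<open>\<open>X'\<close> is an open part of a trivial bundle over \<open>X\<close>: the map \<open>ext\<close> sends a base point and
  fibre coordinates to the total space, and \<open>t\<close> recovers the fibre coordinates.\<close>

lemma fractional_iso_extend:
  fixes I I' :: "'i set" and S :: "'s set"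
    and ext :: "('i \<Rightarrow> complex) \<Rightarrow> ('s \<Rightarrow> complex) \<Rightarrow> 'i \<Rightarrow> complex"
  assumes iso: "fractional_iso I X {..<m} U" and U: "zariski_open {..<m} U"
    and S: "finite S" "card S = k"
    and II': "I \<subseteq> I'"
    and base: "\<And>x'. x' \<in> X' \<Longrightarrow> restrict x' I \<in> X"
    and t: "\<And>b. b \<in> S \<Longrightarrow> fractional I' X' (t b)"
    and ext_t: "\<And>x'. x' \<in> X' \<Longrightarrow> ext (restrict x' I) (\<lambda>b\<in>S. t b x') = x'"
    and ext_base: "\<And>x c. x \<in> X \<Longrightarrow> restrict (ext x c) I = x"
    and t_ext: "\<And>x c b. x \<in> X \<Longrightarrow> b \<in> S \<Longrightarrow> t b (ext x c) = c b"
    and f: "f \<in> poly_funs I'"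
    and X': "\<And>x c. x \<in> X \<Longrightarrow> ext x c \<in> X' \<longleftrightarrow> f (ext x c) \<noteq> 0"
    and ext: "\<And>(Z :: (nat \<Rightarrow> complex) set) J \<xi> c i.
        \<xi> ` Z \<subseteq> X \<Longrightarrow> (\<And>i. i \<in> I \<Longrightarrow> fractional J Z (\<lambda>z. \<xi> z i)) \<Longrightarrow>
        (\<And>b. b \<in> S \<Longrightarrow> fractional J Z (\<lambda>z. c z b)) \<Longrightarrow> i \<in> I' \<Longrightarrow>
        fractional J Z (\<lambda>z. ext (\<xi> z) (c z) i)"
  shows "\<exists>U'. zariski_open {..<m + k} U' \<and> fractional_iso I' X' {..<m + k} U'"
proof -
  obtain \<phi> \<psi> where \<phi>X: "\<phi> ` X \<subseteq> U" and \<psi>U: "\<psi> ` U \<subseteq> X"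
    and \<phi>: "\<And>j. j < m \<Longrightarrow> fractional I X (\<lambda>x. \<phi> x j)"
    and \<psi>: "\<And>i. i \<in> I \<Longrightarrow> fractional {..<m} U (\<lambda>y. \<psi> y i)"
    and \<psi>\<phi>: "\<And>x. x \<in> X \<Longrightarrow> \<psi> (\<phi> x) = x" and \<phi>\<psi>: "\<And>y. y \<in> U \<Longrightarrow> \<phi> (\<psi> y) = y"
    using iso unfolding fractional_iso_def by auto
  \<comment> \<open>The \<open>k\<close> fibre coordinates, indexed by \<open>S\<close>, are placed
    after the first \<open>m\<close> ones: \<open>b\<close> gets position \<open>m + g b\<close>,
    and \<open>e\<close> inverts \<open>g\<close>.\<close>
  obtain e where e: "bij_betw e {..<k} S"
    using S ex_bij_betw_nat_finite[OF S(1)] by (auto simp: atLeast0LessThan)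
  define g where "g = inv_into {..<k} e"
  have g: "bij_betw g S {..<k}" and eg: "\<And>b. b \<in> S \<Longrightarrow> e (g b) = b"
    and ge: "\<And>j. j < k \<Longrightarrow> g (e j) = j"
    using e unfolding g_def
    by (auto simp: bij_betw_inv_into bij_betw_inv_into_left bij_betw_inv_into_right)
  have gk: "g b < k" if "b \<in> S" for b
    using g that by (auto simp: bij_betw_def)
  have eS: "e j \<in> S" if "j < k" for j
    using e that by (auto simp: bij_betw_def)
  let ?pr = "\<lambda>y::nat \<Rightarrow> complex. restrict y {..<m}"
  let ?c = "\<lambda>y::nat \<Rightarrow> complex. \<lambda>b\<in>S. y (m + g b)"
  define \<psi>' where "\<psi>' y = ext (\<psi> (?pr y)) (?c y)" for y
  define \<phi>' where "\<phi>' x' = (\<lambda>j\<in>{..<m + k}. if j < m then \<phi> (restrict x' I) j else t (e (j - m)) x')"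
    for x'
  define W where "W = {y \<in> affine_space {..<m + k}. ?pr y \<in> U}"
  have W: "zariski_open {..<m + k} W"
    unfolding W_def by (rule zariski_open_cylinder[OF U]) auto
  have \<psi>W: "(\<lambda>y. \<psi> (?pr y)) ` W \<subseteq> X"
    using \<psi>U unfolding W_def by blast
  have frac_W: "fractional {..<m + k} W (\<lambda>y. \<psi>' y i)" if "i \<in> I'" for i
    unfolding \<psi>'_def
  \<comment> \<open>Here \<open>ext\<close> is the hypothesis of that name, not function
    extensionality. It is applied over the whole cylinder \<open>W\<close>, because
    \<open>U'\<close> can be defined only once the pullback of \<open>f\<close> is known to be a
    fraction.\<close>
  proof (rule ext[OF \<psi>W _ _ that])
    fix i assume "i \<in> I"
    show "fractional {..<m + k} W (\<lambda>y. \<psi> (?pr y) i)"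
      by (rule fractional_comp[OF \<psi>[OF \<open>i \<in> I\<close>]]) (auto simp: W_def intro: fractional_coord)
  next
    fix b assume "b \<in> S"
    then show "fractional {..<m + k} W (\<lambda>y. ?c y b)"
      using gk by (auto intro!: fractional_coord)
  qed
  have "fractional {..<m + k} W (\<lambda>y. f (\<psi>' y))"
    by (rule fractional_poly_comp[OF f frac_W])
  then obtain a h where ah: "a \<in> poly_funs {..<m + k}" "\<forall>y\<in>W. h y \<noteq> 0 \<and> f (\<psi>' y) = a y / h y"
    unfolding fractional_def by blast
  \<comment> \<open>The denominator \<open>h\<close> has no zero on \<open>W\<close>, so the
    pullback of \<open>f\<close> vanishes exactly where the polynomial \<open>a\<close> does. This
    makes \<open>U'\<close> open.\<close>
  define U' where "U' = {y \<in> W. a y \<noteq> 0}"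
  have U'_iff: "y \<in> U' \<longleftrightarrow> y \<in> W \<and> \<psi>' y \<in> X'" for y
  proof -
    have "\<psi>' y \<in> X' \<longleftrightarrow> a y \<noteq> 0" if "y \<in> W"
      using X'[of "\<psi> (?pr y)" "?c y"] that ah(2) \<psi>W unfolding \<psi>'_def by auto
    then show ?thesis
      unfolding U'_def by blast
  qed
  have open_U': "zariski_open {..<m + k} U'"
    unfolding U'_def by (rule zariski_open_inter_nonvanishing[OF W ah(1)])
  have pr_\<phi>': "?pr (\<phi>' x') = \<phi> (restrict x' I)" if "x' \<in> X'" for x'
  proof -
    have "\<phi> (restrict x' I) \<in> affine_space {..<m}"
      using \<phi>X base[OF that] U unfolding zariski_open_def by blast
    then show ?thesis
      unfolding \<phi>'_def affine_space_def by (intro extensionalityI[of _ "{..<m}"]) (auto simp: PiE_def)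
  qed
  have c_\<phi>': "?c (\<phi>' x') = (\<lambda>b\<in>S. t b x')" for x'
    by (rule restrict_ext) (simp add: \<phi>'_def gk eg)
  have \<psi>'\<phi>': "\<psi>' (\<phi>' x') = x'" if "x' \<in> X'" for x'
    unfolding \<psi>'_def pr_\<phi>'[OF that] c_\<phi>' using \<psi>\<phi> base ext_t that by simp
  have "\<phi>' ` X' \<subseteq> U'"
  proof (intro image_subsetI)
    fix x' assume x': "x' \<in> X'"
    have "\<phi>' x' \<in> affine_space {..<m + k}"
      by (simp add: \<phi>'_def affine_space_def)
    then show "\<phi>' x' \<in> U'"
      unfolding U'_iff W_def using pr_\<phi>'[OF x'] \<psi>'\<phi>'[OF x'] \<phi>X base[OF x'] x' by auto
  qed
  moreover have "\<psi>' ` U' \<subseteq> X'"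
    using U'_iff by blast
  moreover have "fractional I' X' (\<lambda>x'. \<phi>' x' j)" if "j < m + k" for j
  proof (cases "j < m")
    case True
    have "fractional I' X' (\<lambda>x'. \<phi> (restrict x' I) j)"
      by (rule fractional_comp[OF \<phi>[OF True]]) (use base II' in \<open>auto intro: fractional_coord\<close>)
    then show ?thesis
      using True by (simp add: \<phi>'_def)
  next
    case False
    then have "e (j - m) \<in> S"
      using that by (intro eS) auto
    then show ?thesis
      using t False that by (simp add: \<phi>'_def)
  qed
  moreover have "fractional {..<m + k} U' (\<lambda>y. \<psi>' y i)" if "i \<in> I'" for i
    using frac_W[OF that] by (rule fractional_subset) (auto simp: U'_def)
  moreover have "\<phi>' (\<psi>' y) = y" if "y \<in> U'" for y
  proof (rule extensionalityI[of _ "{..<m + k}"])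
    have yW: "y \<in> W"
      using that U'_iff by blast
    then have X: "\<psi> (?pr y) \<in> X"
      using \<psi>W by blast
    show "\<phi>' (\<psi>' y) \<in> extensional {..<m + k}" "y \<in> extensional {..<m + k}"
      using yW by (auto simp: \<phi>'_def W_def affine_space_def PiE_def)
    fix j assume j: "j \<in> {..<m + k}"
    show "\<phi>' (\<psi>' y) j = y j"
    proof (cases "j < m")
      case True
      have "\<phi> (restrict (\<psi>' y) I) = ?pr y"
        unfolding \<psi>'_def ext_base[OF X] using yW \<phi>\<psi> by (simp add: W_def)
      then show ?thesis
        using True by (simp add: \<phi>'_def)
    next
      case False
      then have "j - m < k" using j by auto
      then show ?thesis
        using False j by (simp add: \<phi>'_def \<psi>'_def t_ext[OF X] eS ge)
    qed
  qed
  ultimately have "fractional_iso I' X' {..<m + k} U'"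
    unfolding fractional_iso_def using \<psi>'\<phi>' by (intro exI[of _ \<phi>'] exI[of _ \<psi>']) auto
  with open_U' show ?thesis by blast
qed

text \<open>A mere renumbering of coordinates, obtained from the extension lemma over a one-point
  base. It starts the induction.\<close>

lemma fractional_iso_nonvanishing:
  fixes I :: "'i set"
  assumes "finite I" "card I = k" "f \<in> poly_funs I"
  shows "\<exists>U. zariski_open {..<k} U \<and> fractional_iso I {x \<in> affine_space I. f x \<noteq> 0} {..<k} U"
proof -
  \<comment> \<open>Extensionality on the empty index set leaves a single function, constantly
    \<open>undefined\<close>, as the point of zero-dimensional space.\<close>
  have aff0: "affine_space {} = {\<lambda>_. undefined :: complex}"
    by (simp add: affine_space_def)
  have "fractional_iso ({} :: 'i set) (affine_space {}) {..<0::nat} (affine_space {})"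
    unfolding fractional_iso_def aff0
    by (rule exI[of _ "\<lambda>_ _. undefined"], rule exI[of _ "\<lambda>_ _. undefined"]) simp
  moreover have "zariski_open {..<0::nat} (affine_space {})"
    using zariski_open_affine_space[of "{} :: nat set"] by simp
  ultimately have "\<exists>U. zariski_open {..<0 + k} U \<and>
      fractional_iso I {x \<in> affine_space I. f x \<noteq> 0} {..<0 + k} U"
    using assms(1,2) empty_subsetI
  proof (rule fractional_iso_extend[where t = "\<lambda>b x. x b" and ext = "\<lambda>x c. restrict c I" and f = f])
    show "f \<in> poly_funs I" by (fact assms(3))
    show "restrict x' {} \<in> affine_space {}" for x' :: "'i \<Rightarrow> complex"
      by (simp add: aff0 restrict_def)
    show "restrict (\<lambda>b\<in>I. x' b) I = x'" if "x' \<in> {x \<in> affine_space I. f x \<noteq> 0}" for x'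
      using that by (auto simp: affine_space_def)
    show "restrict (restrict c I) {} = x" if "x \<in> affine_space {}" for x c :: "'i \<Rightarrow> complex"
      using that by (simp add: aff0 restrict_def)
    show "restrict c I \<in> {x \<in> affine_space I. f x \<noteq> 0} \<longleftrightarrow> f (restrict c I) \<noteq> 0" for c
      by (simp add: affine_space_def)
  qed (simp_all add: fractional_coord)
  then show ?thesis by simp
qed

section \<open>Families of vectors and Cramer's rule\<close>

lemma linearly_dependent_family_mono:
  assumes "linearly_dependent_family n \<gamma> S" "S \<subseteq> T" "finite T"
  shows "linearly_dependent_family n \<gamma> T"
proof -
  obtain c p where c: "p \<in> S" "c p \<noteq> 0" "\<forall>j<n. (\<Sum>q\<in>S. c q * \<gamma> (q, j)) = 0"
    using assms(1) unfolding linearly_dependent_family_def by blast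
  let ?c = "\<lambda>q. if q \<in> S then c q else 0"
  have "(\<Sum>q\<in>T. ?c q * \<gamma> (q, j)) = (\<Sum>q\<in>S. c q * \<gamma> (q, j))" for j
    by (rule sum.mono_neutral_cong_right[OF assms(3,2)]) auto
  then show ?thesis
    unfolding linearly_dependent_family_def using c assms(2)
    by (intro exI[of _ ?c]) auto
qed

lemma linearly_dependent_family_cong:
  assumes "\<And>q j. q \<in> S \<Longrightarrow> j < n \<Longrightarrow> \<gamma> (q, j) = \<delta> (q, j)"
  shows "linearly_dependent_family n \<gamma> S \<longleftrightarrow> linearly_dependent_family n \<delta> S"
proof -
  have "(\<Sum>p\<in>S. c p * \<gamma> (p, j)) = (\<Sum>p\<in>S. c p * \<delta> (p, j))" if "j < n" for c j
    using assms that by (intro sum.cong) auto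
  then show ?thesis
    unfolding linearly_dependent_family_def by simp
qed

section \<open>Linear spans of families\<close>

definition in_span :: "nat \<Rightarrow> ('a \<times> nat \<Rightarrow> complex) \<Rightarrow> 'a set \<Rightarrow> (nat \<Rightarrow> complex) \<Rightarrow> bool" where
  "in_span n \<gamma> S u \<longleftrightarrow> (\<exists>c. \<forall>i<n. u i = (\<Sum>q\<in>S. c q * \<gamma> (q, i)))"

lemma in_span_cong:
  assumes "\<And>q j. q \<in> S \<Longrightarrow> j < n \<Longrightarrow> \<gamma> (q, j) = \<delta> (q, j)" "\<And>j. j < n \<Longrightarrow> u j = v j"
  shows "in_span n \<gamma> S u \<longleftrightarrow> in_span n \<delta> S v"
proof -
  have "(\<Sum>p\<in>S. c p * \<gamma> (p, j)) = (\<Sum>p\<in>S. c p * \<delta> (p, j))" if "j < n" for c j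
    using assms that by (intro sum.cong) auto
  then show ?thesis
    unfolding in_span_def using assms(2) by simp
qed

lemma in_span_member:
  assumes "finite S" "q \<in> S"
  shows "in_span n \<gamma> S (\<lambda>i. \<gamma> (q, i))"
  unfolding in_span_def using assms
  by (intro exI[of _ "\<lambda>r. if r = q then 1 else 0"]) (simp add: if_distrib[of "\<lambda>x. x * _"] cong: if_cong)

lemma in_span_diff:
  assumes "in_span n \<gamma> S u" "in_span n \<gamma> S v"
  shows "in_span n \<gamma> S (\<lambda>i. u i - v i)"
proof -
  obtain c d where "\<forall>i<n. u i = (\<Sum>q\<in>S. c q * \<gamma> (q, i))" "\<forall>i<n. v i = (\<Sum>q\<in>S. d q * \<gamma> (q, i))"
    using assms unfolding in_span_def by blast
  then show ?thesis
    unfolding in_span_def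
    by (intro exI[of _ "\<lambda>q. c q - d q"]) (simp add: sum_subtractf left_diff_distrib)
qed

lemma in_span_combination:
  assumes "\<And>b. b \<in> T \<Longrightarrow> in_span n \<gamma> S (v b)"
  shows "in_span n \<gamma> S (\<lambda>i. \<Sum>b\<in>T. c b * v b i)"
proof -
  have "\<forall>b\<in>T. \<exists>d. \<forall>i<n. v b i = (\<Sum>q\<in>S. d q * \<gamma> (q, i))"
    using assms unfolding in_span_def by blast
  then obtain d where d: "\<And>b i. b \<in> T \<Longrightarrow> i < n \<Longrightarrow> v b i = (\<Sum>q\<in>S. d b q * \<gamma> (q, i))"
    by metis
  have "(\<Sum>b\<in>T. c b * v b i) = (\<Sum>q\<in>S. (\<Sum>b\<in>T. c b * d b q) * \<gamma> (q, i))" if "i < n" for i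
  proof -
    have "(\<Sum>b\<in>T. c b * v b i) = (\<Sum>b\<in>T. \<Sum>q\<in>S. c b * (d b q * \<gamma> (q, i)))"
      using d that by (simp add: sum_distrib_left)
    also have "\<dots> = (\<Sum>q\<in>S. \<Sum>b\<in>T. c b * (d b q * \<gamma> (q, i)))"
      by (rule sum.swap)
    finally show ?thesis
      by (simp add: sum_distrib_right mult.assoc)
  qed
  then show ?thesis
    unfolding in_span_def by (intro exI[of _ "\<lambda>q. \<Sum>b\<in>T. c b * d b q"]) simp
qed

lemma in_span_trans:
  assumes "in_span n \<gamma> T u" "\<And>b. b \<in> T \<Longrightarrow> in_span n \<gamma> S (\<lambda>i. \<gamma> (b, i))"
  shows "in_span n \<gamma> S u"
proof -
  obtain c where c: "\<forall>i<n. u i = (\<Sum>q\<in>T. c q * \<gamma> (q, i))"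
    using assms(1) unfolding in_span_def by blast
  have "in_span n \<gamma> S (\<lambda>i. \<Sum>b\<in>T. c b * \<gamma> (b, i))"
    by (rule in_span_combination) (rule assms(2))
  then show ?thesis
    using c by (subst in_span_cong[where \<delta> = \<gamma> and v = "\<lambda>i. \<Sum>b\<in>T. c b * \<gamma> (b, i)"]) auto
qed

lemma linearly_dependent_insertI:
  assumes "in_span n \<gamma> S (\<lambda>i. \<gamma> (p, i))" "finite S" "p \<notin> S"
  shows "linearly_dependent_family n \<gamma> (insert p S)"
proof -
  obtain c where c: "\<forall>i<n. \<gamma> (p, i) = (\<Sum>q\<in>S. c q * \<gamma> (q, i))"
    using assms(1) unfolding in_span_def by blast
  let ?c = "\<lambda>q. if q = p then -1 else c q"
  have "(\<Sum>q\<in>S. ?c q * \<gamma> (q, i)) = (\<Sum>q\<in>S. c q * \<gamma> (q, i))" for i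
    using assms(3) by (intro sum.cong) auto
  then show ?thesis
    unfolding linearly_dependent_family_def using c assms(2,3)
    by (intro exI[of _ ?c]) simp
qed

lemma in_span_if_linearly_dependent_insert:
  assumes "linearly_dependent_family n \<gamma> (insert p S)" "\<not> linearly_dependent_family n \<gamma> S"
    "finite S" "p \<notin> S"
  shows "in_span n \<gamma> S (\<lambda>i. \<gamma> (p, i))"
proof -
  obtain c r where r: "r \<in> insert p S" "c r \<noteq> 0"
    and c: "\<forall>i<n. (\<Sum>q\<in>insert p S. c q * \<gamma> (q, i)) = 0"
    using assms(1) unfolding linearly_dependent_family_def by blast
  have c': "\<forall>i<n. c p * \<gamma> (p, i) + (\<Sum>q\<in>S. c q * \<gamma> (q, i)) = 0"
    using c assms(3,4) by simp
  have "c p \<noteq> 0"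
  proof
    assume "c p = 0"
    then have "r \<in> S" "\<forall>i<n. (\<Sum>q\<in>S. c q * \<gamma> (q, i)) = 0"
      using r c' by auto
    then show False
      using assms(2) r(2) unfolding linearly_dependent_family_def by blast
  qed
  have "\<gamma> (p, i) = (\<Sum>q\<in>S. (- c q / c p) * \<gamma> (q, i))" if "i < n" for i
  proof -
    have "(\<Sum>q\<in>S. (- c q / c p) * \<gamma> (q, i)) = - (\<Sum>q\<in>S. c q * \<gamma> (q, i)) / c p"
      by (simp add: sum_divide_distrib sum_negf)
    also have "\<dots> = \<gamma> (p, i)"
      using c' that \<open>c p \<noteq> 0\<close> by (simp add: field_simps add_eq_0_iff)
    finally show ?thesis ..
  qed
  then show ?thesis
    unfolding in_span_def by (intro exI[of _ "\<lambda>q. - c q / c p"]) blast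
qed

text \<open>The difference of the two expansions of \<open>u\<close> is a relation on
  \<open>S \<union> T\<close>, so all its coefficients vanish. This is the directness of the sum of
  the two spans.\<close>

lemma in_span_disjoint_eq_0:
  assumes "in_span n \<gamma> S u" "in_span n \<gamma> T u" "S \<inter> T = {}" "finite S" "finite T"
    and "\<not> linearly_dependent_family n \<gamma> (S \<union> T)" and "i < n"
  shows "u i = 0"
proof -
  obtain c d where c: "\<And>i. i < n \<Longrightarrow> u i = (\<Sum>q\<in>S. c q * \<gamma> (q, i))"
    and d: "\<And>i. i < n \<Longrightarrow> u i = (\<Sum>q\<in>T. d q * \<gamma> (q, i))"
    using assms(1,2) unfolding in_span_def by blast
  let ?e = "\<lambda>q. if q \<in> S then c q else - d q"
  have zero: "(\<Sum>q\<in>S \<union> T. ?e q * \<gamma> (q, i)) = 0" if "i < n" for i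
  proof -
    have "(\<Sum>q\<in>S \<union> T. ?e q * \<gamma> (q, i)) = (\<Sum>q\<in>S. ?e q * \<gamma> (q, i)) + (\<Sum>q\<in>T. ?e q * \<gamma> (q, i))"
      by (rule sum.union_disjoint) (use assms in auto)
    also have "(\<Sum>q\<in>S. ?e q * \<gamma> (q, i)) = u i"
      unfolding c[OF that] by (rule sum.cong) auto
    also have "(\<Sum>q\<in>T. ?e q * \<gamma> (q, i)) = - u i"
      unfolding d[OF that] sum_negf[symmetric] by (rule sum.cong) (use assms(3) in auto)
    finally show ?thesis by simp
  qed
  have "c q = 0" if "q \<in> S" for q
  proof (rule ccontr)
    assume "c q \<noteq> 0"
    then have "\<exists>q\<in>S \<union> T. ?e q \<noteq> 0"
      using that by (intro bexI[of _ q]) auto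
    then have "linearly_dependent_family n \<gamma> (S \<union> T)"
      unfolding linearly_dependent_family_def using zero by (intro exI[of _ ?e]) simp
    then show False
      using assms(6) by contradiction
  qed
  then show ?thesis
    unfolding c[OF \<open>i < n\<close>] by simp
qed

section \<open>Determinants of square families and Cramer's rule\<close>

text \<open>A determinant needs its columns numbered. Any numbering will do, since only vanishing
  and quotients of determinants matter, but it must depend on \<open>T\<close> alone: then numerator
  and denominator share it, and the determinant is one polynomial in the family.\<close>

definition column_order :: "'a set \<Rightarrow> nat \<Rightarrow> 'a" where
  "column_order T = (SOME h. bij_betw h {..<card T} T)"

lemma bij_betw_column_order: "finite T \<Longrightarrow> bij_betw (column_order T) {..<card T} T"
  unfolding column_order_def
  by (rule someI_ex[where P = "\<lambda>h. bij_betw h {..<card T} T"]) (simp add: ex_bij_betw_nat_finite flip: atLeast0LessThan)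

definition family_matrix :: "nat \<Rightarrow> ('a \<times> nat \<Rightarrow> complex) \<Rightarrow> 'a set \<Rightarrow> complex mat" where
  "family_matrix n \<gamma> T = mat n n (\<lambda>(i, j). \<gamma> (column_order T j, i))"

definition family_det :: "nat \<Rightarrow> ('a \<times> nat \<Rightarrow> complex) \<Rightarrow> 'a set \<Rightarrow> complex" where
  "family_det n \<gamma> T = det (family_matrix n \<gamma> T)"

text \<open>For \<open>e\<close> in a basis \<open>T\<close> this is the coordinate of
  \<open>u\<close> at \<open>e\<close>. The column is replaced by altering the family at
  \<open>e\<close>, so facts about \<open>family_det\<close> apply to the numerator
  unchanged.\<close>

definition cramer_coeff ::
  "nat \<Rightarrow> ('a \<times> nat \<Rightarrow> complex) \<Rightarrow> 'a set \<Rightarrow> 'a \<Rightarrow> (nat \<Rightarrow> complex) \<Rightarrow> complex" where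
  "cramer_coeff n \<gamma> T e u =
     family_det n (\<lambda>(q, i). if q = e then u i else \<gamma> (q, i)) T / family_det n \<gamma> T"

lemma family_matrix_carrier: "family_matrix n \<gamma> T \<in> carrier_mat n n"
  by (simp add: family_matrix_def)

lemma column_order_in: "finite T \<Longrightarrow> card T = n \<Longrightarrow> j < n \<Longrightarrow> column_order T j \<in> T"
  using bij_betw_column_order[of T] by (auto simp: bij_betw_def)

lemma column_order_surj:
  assumes "finite T" "card T = n" "q \<in> T"
  obtains j where "j < n" "column_order T j = q"
  using bij_betw_column_order[OF assms(1)] assms(2,3) unfolding bij_betw_def
  by (metis imageE lessThan_iff)

lemma family_det_cong:
  assumes "finite T" "card T = n" "\<And>q j. q \<in> T \<Longrightarrow> j < n \<Longrightarrow> \<gamma> (q, j) = \<delta> (q, j)"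
  shows "family_det n \<gamma> T = family_det n \<delta> T"
proof -
  have "family_matrix n \<gamma> T = family_matrix n \<delta> T"
    unfolding family_matrix_def using column_order_in[OF assms(1,2)] assms(3)
    by (intro cong_mat) auto
  then show ?thesis by (simp add: family_det_def)
qed

lemma cramer_coeff_cong:
  assumes "finite T" "card T = n" "\<And>q j. q \<in> T \<Longrightarrow> j < n \<Longrightarrow> \<gamma> (q, j) = \<delta> (q, j)"
    and "\<And>j. j < n \<Longrightarrow> u j = v j"
  shows "cramer_coeff n \<gamma> T e u = cramer_coeff n \<delta> T e v"
proof -
  have "family_det n (\<lambda>(q, i). if q = e then u i else \<gamma> (q, i)) T =
      family_det n (\<lambda>(q, i). if q = e then v i else \<delta> (q, i)) T"
    by (rule family_det_cong) (use assms in auto)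
  moreover have "family_det n \<gamma> T = family_det n \<delta> T"
    by (rule family_det_cong) (use assms in auto)
  ultimately show ?thesis
    by (simp add: cramer_coeff_def)
qed

text \<open>The Leibniz expansion exhibits the determinant as a polynomial in the coordinates of the
  vectors indexed by \<open>T\<close>.\<close>

lemma family_det_poly:
  assumes "finite T" "card T = n" "T \<times> {..<n} \<subseteq> I"
  shows "(\<lambda>\<gamma>. family_det n \<gamma> T) \<in> poly_funs I"
proof -
  have "family_det n \<gamma> T = (\<Sum>p\<in>{p. p permutes {0..<n}}.
      signof p * (\<Prod>i = 0..<n. family_matrix n \<gamma> T $$ (i, p i)))" for \<gamma>
    unfolding family_det_def by (rule det_def'[OF family_matrix_carrier])
  also have "\<dots> \<gamma> = (\<Sum>p\<in>{p. p permutes {0..<n}}.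
      signof p * (\<Prod>i = 0..<n. \<gamma> (column_order T (p i), i)))" for \<gamma>
    by (intro sum.cong arg_cong2[where f = times] refl prod.cong)
      (auto simp: family_matrix_def dest: permutes_in_image)
  finally have eq: "(\<lambda>\<gamma>. family_det n \<gamma> T) = (\<lambda>\<gamma>. \<Sum>p\<in>{p. p permutes {0..<n}}.
      signof p * (\<Prod>i = 0..<n. \<gamma> (column_order T (p i), i)))"
    by blast
  have "(column_order T (p i), i) \<in> I" if "p permutes {0..<n}" "i \<in> {0..<n}" for p i
  proof -
    have "p i < n"
      using that permutes_in_image[OF that(1), of i] by simp
    then show ?thesis
      using column_order_in[OF assms(1,2)] assms(3) that(2) by auto
  qed
  then show ?thesis
    unfolding eq
    by (intro poly_funs_sum poly_funs.mult poly_funs.const poly_funs_prod poly_funs.coord) auto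
qed

lemma family_matrix_mult:
  assumes "finite T" "card T = n" "i < n"
  shows "(family_matrix n \<gamma> T *\<^sub>v vec n (\<lambda>j. c (column_order T j))) $ i = (\<Sum>q\<in>T. c q * \<gamma> (q, i))"
proof -
  have "(\<Sum>q\<in>T. c q * \<gamma> (q, i)) = (\<Sum>j<n. c (column_order T j) * \<gamma> (column_order T j, i))"
    using sum.reindex_bij_betw[OF bij_betw_column_order[OF assms(1)], of "\<lambda>q. c q * \<gamma> (q, i)"] assms(2)
    by simp
  then show ?thesis
    using assms(3) by (simp add: family_matrix_def scalar_prod_def mult.commute atLeast0LessThan)
qed

lemma vec_as_column_coeffs:
  assumes "finite T" "card T = n" "v \<in> carrier_vec n"
  obtains c where "v = vec n (\<lambda>j. c (column_order T j))"
proof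
  let ?g = "inv_into {..<n} (column_order T)"
  have "?g (column_order T j) = j" if "j < n" for j
    using bij_betw_column_order[OF assms(1)] assms(2) that by (simp add: bij_betw_def inv_into_f_f)
  then show "v = vec n (\<lambda>j. (\<lambda>q. v $ ?g q) (column_order T j))"
    using assms(3) by (intro eq_vecI) auto
qed

lemma family_det_eq_0_iff:
  assumes T: "finite T" "card T = n"
  shows "family_det n \<gamma> T = 0 \<longleftrightarrow> linearly_dependent_family n \<gamma> T"
proof
  assume "family_det n \<gamma> T = 0"
  then obtain v where v: "v \<in> carrier_vec n" "v \<noteq> 0\<^sub>v n" "family_matrix n \<gamma> T *\<^sub>v v = 0\<^sub>v n"
    unfolding family_det_def det_0_iff_vec_prod_zero_field[OF family_matrix_carrier] by blast
  obtain c where c: "v = vec n (\<lambda>j. c (column_order T j))"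
    using vec_as_column_coeffs[OF T v(1)] .
  have "\<exists>j<n. c (column_order T j) \<noteq> 0"
  proof (rule ccontr)
    assume "\<not> ?thesis"
    then have "v = 0\<^sub>v n" unfolding c by (intro eq_vecI) auto
    then show False using v(2) by contradiction
  qed
  moreover have "(\<Sum>q\<in>T. c q * \<gamma> (q, i)) = 0" if "i < n" for i
    unfolding family_matrix_mult[OF T that, symmetric] using v(3) that c by simp
  ultimately show "linearly_dependent_family n \<gamma> T"
    unfolding linearly_dependent_family_def using column_order_in[OF T] by blast
next
  assume "linearly_dependent_family n \<gamma> T"
  then obtain c q where c: "q \<in> T" "c q \<noteq> 0" "\<forall>i<n. (\<Sum>q\<in>T. c q * \<gamma> (q, i)) = 0"
    unfolding linearly_dependent_family_def by blast
  let ?v = "vec n (\<lambda>j. c (column_order T j))"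
  obtain j where j: "j < n" "column_order T j = q"
    using column_order_surj[OF T c(1)] .
  have "?v $ j \<noteq> 0"
    using j c(2) by simp
  then have "?v \<noteq> 0\<^sub>v n"
    using j(1) by (metis index_zero_vec(1))
  moreover have "family_matrix n \<gamma> T *\<^sub>v ?v = 0\<^sub>v n"
    by (intro eq_vecI) (use c(3) family_matrix_mult[OF T, where c = c and \<gamma> = \<gamma>] family_matrix_carrier[of n \<gamma> T] in auto)
  ultimately show "family_det n \<gamma> T = 0"
    unfolding family_det_def det_0_iff_vec_prod_zero_field[OF family_matrix_carrier]
    by (intro exI[of _ ?v]) simp
qed

text \<open>Replacing column \<open>e\<close> by the combination with coefficients \<open>c\<close>
  multiplies the determinant by \<open>c e\<close>; hence any expansion of \<open>u\<close> over
  \<open>T\<close> must have the Cramer quotient as its coefficient.\<close>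

lemma cramer_coeff_unique:
  assumes T: "finite T" "card T = n" and det: "family_det n \<gamma> T \<noteq> 0"
    and u: "\<And>i. i < n \<Longrightarrow> u i = (\<Sum>q\<in>T. c q * \<gamma> (q, i))" and e: "e \<in> T"
  shows "cramer_coeff n \<gamma> T e u = c e"
proof -
  let ?v = "vec n (\<lambda>j. c (column_order T j))"
  let ?A = "family_matrix n \<gamma> T"
  obtain k where k: "k < n" "column_order T k = e"
    using column_order_surj[OF T e] .
  have inj: "column_order T j = e \<longleftrightarrow> j = k" if "j < n" for j
    using bij_betw_column_order[OF T(1)] T(2) that k by (auto simp: bij_betw_def inj_on_def)
  have "replace_col ?A (?A *\<^sub>v ?v) k = family_matrix n (\<lambda>(q, i). if q = e then u i else \<gamma> (q, i)) T"
  proof (rule eq_matI)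
    fix i j
    assume "i < dim_row (family_matrix n (\<lambda>(q, i). if q = e then u i else \<gamma> (q, i)) T)"
      and "j < dim_col (family_matrix n (\<lambda>(q, i). if q = e then u i else \<gamma> (q, i)) T)"
    then have ij: "i < n" "j < n" by (auto simp: family_matrix_def)
    show "replace_col ?A (?A *\<^sub>v ?v) k $$ (i, j) =
        family_matrix n (\<lambda>(q, i). if q = e then u i else \<gamma> (q, i)) T $$ (i, j)"
    proof (cases "j = k")
      case True
      have "replace_col ?A (?A *\<^sub>v ?v) k $$ (i, j) = (?A *\<^sub>v ?v) $ i"
        using ij True family_matrix_carrier[of n \<gamma> T] by (simp add: replace_col_def)
      also have "\<dots> = u i"
        unfolding family_matrix_mult[OF T ij(1)] u[OF ij(1)] ..
      also have "\<dots> = family_matrix n (\<lambda>(q, i). if q = e then u i else \<gamma> (q, i)) T $$ (i, j)"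
        using ij True k by (simp add: family_matrix_def)
      finally show ?thesis .
    next
      case False
      then show ?thesis
        using ij inj by (simp add: replace_col_def family_matrix_def)
    qed
  qed (auto simp: replace_col_def family_matrix_def)
  then have "family_det n (\<lambda>(q, i). if q = e then u i else \<gamma> (q, i)) T = c e * family_det n \<gamma> T"
    using cramer_lemma_mat[OF family_matrix_carrier[of n \<gamma> T] vec_carrier k(1), of "\<lambda>j. c (column_order T j)"] k
    by (simp add: family_det_def)
  then show ?thesis
    using det by (simp add: cramer_coeff_def)
qed

text \<open>The adjugate divided by the determinant inverts the matrix, and applying it to
  \<open>u\<close> yields the coefficients.\<close>

lemma in_span_full:
  assumes T: "finite T" "card T = n" and det: "family_det n \<gamma> T \<noteq> 0"
  shows "in_span n \<gamma> T u"
proof -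
  let ?A = "family_matrix n \<gamma> T"
  note A = family_matrix_carrier[of n \<gamma> T]
  note adj = adj_mat[OF A]
  let ?d = "det ?A"
  have d: "?d \<noteq> 0" using det by (simp add: family_det_def)
  let ?v = "(1 / ?d) \<cdot>\<^sub>v (adj_mat ?A *\<^sub>v vec n u)"
  have v: "?v \<in> carrier_vec n" using adj(1) by simp
  have "?A *\<^sub>v ?v = (1 / ?d) \<cdot>\<^sub>v (?A *\<^sub>v (adj_mat ?A *\<^sub>v vec n u))"
    using A adj(1) by (intro mult_mat_vec) auto
  also have "?A *\<^sub>v (adj_mat ?A *\<^sub>v vec n u) = (?A * adj_mat ?A) *\<^sub>v vec n u"
    using A adj(1) by simp
  also have "\<dots> = ?d \<cdot>\<^sub>v vec n u"
    unfolding adj(2) by (intro eq_vecI) (auto simp: scalar_prod_def mult.assoc if_distrib[of "\<lambda>x. x * _"] if_distrib[of "\<lambda>x. _ * x"] cong: if_cong)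
  finally have *: "?A *\<^sub>v ?v = vec n u"
    using d by (simp add: smult_smult_assoc)
  obtain c where c: "?v = vec n (\<lambda>j. c (column_order T j))"
    using vec_as_column_coeffs[OF T v] .
  have "u i = (\<Sum>q\<in>T. c q * \<gamma> (q, i))" if "i < n" for i
    using family_matrix_mult[OF T that, of \<gamma> c] * c that by simp
  then show ?thesis
    unfolding in_span_def by blast
qed

text \<open>Extends Cramer's rule to independent sets with fewer than n elements: complete
  \<open>S\<close> to a basis \<open>T\<close>, and give the added elements coefficient 0.\<close>

lemma cramer_coeff_subset:
  assumes T: "finite T" "card T = n" and det: "family_det n \<gamma> T \<noteq> 0" and "S \<subseteq> T"
    and u: "\<And>i. i < n \<Longrightarrow> u i = (\<Sum>q\<in>S. c q * \<gamma> (q, i))" and e: "e \<in> T"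
  shows "cramer_coeff n \<gamma> T e u = (if e \<in> S then c e else 0)"
proof (rule cramer_coeff_unique[OF T det _ e])
  fix i assume "i < n"
  have "(\<Sum>q\<in>T. (if q \<in> S then c q else 0) * \<gamma> (q, i)) = (\<Sum>q\<in>S. c q * \<gamma> (q, i))"
    by (rule sum.mono_neutral_cong_right[OF T(1) \<open>S \<subseteq> T\<close>]) auto
  then show "u i = (\<Sum>q\<in>T. (if q \<in> S then c q else 0) * \<gamma> (q, i))"
    using u[OF \<open>i < n\<close>] by simp
qed

lemma fractional_family_det:
  assumes T: "finite T" "card T = n"
    and F: "\<And>q i. q \<in> T \<Longrightarrow> i < n \<Longrightarrow> fractional J Z (\<lambda>z. F z (q, i))"
  shows "fractional J Z (\<lambda>z. family_det n (F z) T)"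
  by (rule fractional_poly_comp[OF family_det_poly[OF T order_refl]]) (use F in auto)

lemma fractional_cramer_coeff:
  assumes T: "finite T" "card T = n"
    and F: "\<And>q i. q \<in> T \<Longrightarrow> i < n \<Longrightarrow> fractional J Z (\<lambda>z. F z (q, i))"
    and u: "\<And>i. i < n \<Longrightarrow> fractional J Z (\<lambda>z. u z i)"
    and det: "\<And>z. z \<in> Z \<Longrightarrow> family_det n (F z) T \<noteq> 0"
  shows "fractional J Z (\<lambda>z. cramer_coeff n (F z) T e (u z))"
  unfolding cramer_coeff_def
proof (rule fractional_divide[OF _ _ det])
  show "fractional J Z (\<lambda>z. family_det n (\<lambda>(q, i). if q = e then u z i else F z (q, i)) T)"
  proof (rule fractional_family_det[OF T])
    fix q i assume "q \<in> T" "i < n"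
    then show "fractional J Z (\<lambda>z. case (q, i) of (q, i) \<Rightarrow> if q = e then u z i else F z (q, i))"
      using F u by (cases "q = e") auto
  qed
  show "fractional J Z (\<lambda>z. family_det n (F z) T)"
    using F by (rule fractional_family_det[OF T])
qed

section \<open>Matroid preliminaries\<close>

lemma indep_subset_ground: "matroid M \<Longrightarrow> indep M X \<Longrightarrow> X \<subseteq> ground M"
  unfolding matroid_def by blast

lemma finite_ground: "matroid M \<Longrightarrow> finite (ground M)"
  unfolding matroid_def by blast

lemma indep_finite: "matroid M \<Longrightarrow> indep M X \<Longrightarrow> finite X"
  using finite_subset[OF indep_subset_ground finite_ground] .

lemma indep_empty: "matroid M \<Longrightarrow> indep M {}"
  by (simp add: matroid_def)

lemma indep_mono: "matroid M \<Longrightarrow> indep M X \<Longrightarrow> Y \<subseteq> X \<Longrightarrow> indep M Y"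
  unfolding matroid_def by blast

lemma indep_augment:
  "matroid M \<Longrightarrow> indep M X \<Longrightarrow> indep M Y \<Longrightarrow> card Y < card X \<Longrightarrow> \<exists>x\<in>X - Y. indep M (insert x Y)"
  unfolding matroid_def by blast

lemma finite_indep_cards:
  assumes "matroid M"
  shows "finite {card Y | Y. Y \<subseteq> X \<and> indep M Y}"
proof (rule finite_subset)
  show "{card Y | Y. Y \<subseteq> X \<and> indep M Y} \<subseteq> card ` Pow (ground M)"
    using indep_subset_ground[OF assms] by blast
  show "finite (card ` Pow (ground M))"
    using finite_ground[OF assms] by simp
qed

lemma card_le_rank_of:
  assumes "matroid M" "indep M Y" "Y \<subseteq> X"
  shows "card Y \<le> rank_of M X"
  unfolding rank_of_def by (rule Max_ge[OF finite_indep_cards[OF assms(1)]]) (use assms(2,3) in auto)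

lemma rank_of_attained:
  assumes "matroid M"
  obtains Y where "Y \<subseteq> X" "indep M Y" "card Y = rank_of M X"
proof -
  have "{card Y | Y. Y \<subseteq> X \<and> indep M Y} \<noteq> {}"
    using indep_empty[OF assms] by auto
  then have "rank_of M X \<in> {card Y | Y. Y \<subseteq> X \<and> indep M Y}"
    unfolding rank_of_def by (rule Max_in[OF finite_indep_cards[OF assms]])
  then obtain Y where "Y \<subseteq> X" "indep M Y" "card Y = rank_of M X"
    by auto
  then show thesis
    using that by blast
qed

lemma rank_of_mono:
  assumes "matroid M" "X \<subseteq> Y"
  shows "rank_of M X \<le> rank_of M Y"
proof -
  obtain Z where "Z \<subseteq> X" "indep M Z" "card Z = rank_of M X"
    using rank_of_attained[OF assms(1)] .
  then show ?thesis
    using card_le_rank_of[OF assms(1), of Z Y] assms(2) by auto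
qed

text \<open>As long as \<open>I\<close> is smaller than a largest independent subset of
  \<open>X\<close>, augmentation from that subset enlarges it within \<open>X\<close>.\<close>

lemma indep_extend:
  assumes M: "matroid M" and "indep M I" "I \<subseteq> X"
  obtains J where "I \<subseteq> J" "J \<subseteq> X" "indep M J" "card J = rank_of M X"
proof -
  have "\<exists>J. I \<subseteq> J \<and> J \<subseteq> X \<and> indep M J \<and> card J = rank_of M X"
    using assms(2,3)
  proof (induction "rank_of M X - card I" arbitrary: I rule: less_induct)
    case less
    show ?case
    proof (cases "card I < rank_of M X")
      case False
      then have "card I = rank_of M X"
        using card_le_rank_of[OF M less.prems] by simp
      then show ?thesis
        using less.prems by blast
    next
      case True
      obtain Y where Y: "Y \<subseteq> X" "indep M Y" "card Y = rank_of M X"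
        using rank_of_attained[OF M] .
      obtain x where x: "x \<in> Y - I" "indep M (insert x I)"
        using indep_augment[OF M Y(2) less.prems(1)] True Y(3) by auto
      have "card (insert x I) = Suc (card I)"
        using x(1) indep_finite[OF M less.prems(1)] by simp
      then have "rank_of M X - card (insert x I) < rank_of M X - card I"
        using True by simp
      moreover have "insert x I \<subseteq> X"
        using x(1) Y(1) less.prems(2) by blast
      ultimately show ?thesis
        using less.hyps[OF _ x(2)] by blast
    qed
  qed
  then show thesis
    using that by blast
qed

lemma rank_of_indep:
  assumes "matroid M" "indep M X"
  shows "rank_of M X = card X"
proof -
  obtain J where "X \<subseteq> J" "J \<subseteq> X" "card J = rank_of M X"
    using indep_extend[OF assms order_refl] .
  then show ?thesis
    by auto
qed

text \<open>Extend \<open>B\<close> to a maximal independent \<open>J\<close> in \<open>X\<close>,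
  then to \<open>L\<close> in \<open>insert z X\<close>. Since \<open>L\<close> contains
  \<open>B\<close>, it cannot contain \<open>z\<close>, so it already lies in
  \<open>X\<close>.\<close>

lemma rank_of_insert_absorb:
  assumes M: "matroid M" and B: "indep M B" "B \<subseteq> X" "\<not> indep M (insert z B)"
  shows "rank_of M (insert z X) = rank_of M X"
proof (rule antisym)
  show "rank_of M X \<le> rank_of M (insert z X)"
    by (rule rank_of_mono[OF M]) auto
  obtain J where J: "B \<subseteq> J" "J \<subseteq> X" "indep M J" "card J = rank_of M X"
    using indep_extend[OF M B(1,2)] .
  obtain L where L: "J \<subseteq> L" "L \<subseteq> insert z X" "indep M L" "card L = rank_of M (insert z X)"
    using indep_extend[OF M J(3), of "insert z X"] J(2) by blast
  have "z \<notin> L"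
  proof
    assume "z \<in> L"
    then have "insert z B \<subseteq> L"
      using J(1) L(1) by blast
    then show False
      using indep_mono[OF M L(3)] B(3) by blast
  qed
  then have "L \<subseteq> X"
    using L(2) by blast
  then show "rank_of M (insert z X) \<le> rank_of M X"
    using card_le_rank_of[OF M L(3)] L(4) by simp
qed

text \<open>The dependence of \<open>z\<close> may be witnessed by a different independent
  \<open>B\<close> for each \<open>z\<close>; this is needed when the added points are spread over
  two closures.\<close>

lemma rank_of_union_absorb:
  assumes M: "matroid M" and "finite Z"
    and Z: "\<And>z. z \<in> Z \<Longrightarrow> z \<in> X \<or> (\<exists>B\<subseteq>X. indep M B \<and> \<not> indep M (insert z B))"
  shows "rank_of M (X \<union> Z) = rank_of M X"
  using assms(2) Z
proof (induction Z rule: finite_induct)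
  case (insert z F)
  have "rank_of M (insert z (X \<union> F)) = rank_of M (X \<union> F)"
  proof (cases "z \<in> X")
    case True
    then show ?thesis by (simp add: insert_absorb)
  next
    case False
    then obtain B where "B \<subseteq> X" "indep M B" "\<not> indep M (insert z B)"
      using insert.prems[of z] by blast
    then show ?thesis
      by (intro rank_of_insert_absorb[OF M, of B]) auto
  qed
  then show ?case
    using insert by simp
qed simp

section \<open>Closures and circuits\<close>

lemma cl_ground: "cl M X \<subseteq> ground M"
  unfolding cl_def by blast

lemma cl_superset: "X \<subseteq> ground M \<Longrightarrow> X \<subseteq> cl M X"
  unfolding cl_def by (auto simp: insert_absorb)

lemma cl_dependent:
  assumes M: "matroid M" and z: "z \<in> cl M X" "z \<notin> Q" and Q: "indep M Q" "Q \<subseteq> X" "card Q = rank_of M X"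
  shows "\<not> indep M (insert z Q)"
proof
  assume "indep M (insert z Q)"
  then have "card (insert z Q) \<le> rank_of M (insert z X)"
    using Q(2) by (intro card_le_rank_of[OF M]) auto
  moreover have "card (insert z Q) = Suc (card Q)"
    using z(2) indep_finite[OF M Q(1)] by simp
  ultimately show False
    using z(1) Q(3) unfolding cl_def by simp
qed

lemma rank_of_cl:
  assumes M: "matroid M" and X: "X \<subseteq> ground M"
  shows "rank_of M (cl M X) = rank_of M X"
proof -
  obtain Q where Q: "Q \<subseteq> X" "indep M Q" "card Q = rank_of M X"
    using rank_of_attained[OF M] .
  have "rank_of M (X \<union> cl M X) = rank_of M X"
  proof (rule rank_of_union_absorb[OF M])
    show "finite (cl M X)"
      by (rule finite_subset[OF cl_ground finite_ground[OF M]])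
    show "z \<in> X \<or> (\<exists>B\<subseteq>X. indep M B \<and> \<not> indep M (insert z B))" if "z \<in> cl M X" for z
      using cl_dependent[OF M that _ Q(2,1,3)] Q(1,2) by blast
  qed
  then show ?thesis
    using cl_superset[OF X] by (simp add: Un_absorb1)
qed

lemma circuit_delete:
  assumes M: "matroid M" and C: "circuit M C" "p \<in> C"
  shows "indep M (C - {p})" "rank_of M C = card (C - {p})"
proof -
  have "C - {p} \<subset> C" "C \<subseteq> ground M" "\<not> indep M C"
    using C unfolding circuit_def dependent_set_def by auto
  then show ind: "indep M (C - {p})"
    using C(1) unfolding circuit_def dependent_set_def by blast
  have "insert p (C - {p}) = C"
    using C(2) by blast
  then have "rank_of M C = rank_of M (C - {p})"
    using rank_of_insert_absorb[OF M ind order_refl, of p] \<open>\<not> indep M C\<close> by simp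
  then show "rank_of M C = card (C - {p})"
    using rank_of_indep[OF M ind] by simp
qed

text \<open>A circuit without one of its points is a maximal independent subset of it, and so
  generates the same closure.\<close>

lemma circuit_cl_dependent:
  assumes "matroid M" "circuit M C" "p \<in> C" "z \<in> cl M C" "z \<notin> C - {p}"
  shows "\<not> indep M (insert z (C - {p}))"
  using cl_dependent[OF assms(1,4,5) circuit_delete(1)[OF assms(1-3)]] circuit_delete(2)[OF assms(1-3)]
  by auto

lemma dependent_contains_circuit:
  assumes M: "matroid M" and "dependent_set M X"
  obtains C where "C \<subseteq> X" "circuit M C"
proof -
  have "finite X"
    using assms(2) finite_subset[OF _ finite_ground[OF M]] unfolding dependent_set_def by blast
  then have "\<exists>C\<subseteq>X. circuit M C"
    using assms(2)
  proof (induction X rule: finite_psubset_induct)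
    case (psubset X)
    show ?case
    proof (cases "circuit M X")
      case True
      then show ?thesis by blast
    next
      case False
      then obtain Y where "Y \<subset> X" "dependent_set M Y"
        using psubset.prems unfolding circuit_def by blast
      then show ?thesis
        using psubset.IH[of Y] by blast
    qed
  qed
  then show thesis
    using that by blast
qed

section \<open>Restriction of a matroid\<close>

lemma restriction_simps [simp]:
  "ground (restriction M S) = S"
  "indep (restriction M S) X \<longleftrightarrow> X \<subseteq> S \<and> indep M X"
  by (simp_all add: restriction_def)

lemma matroid_restriction:
  assumes M: "matroid M" and S: "S \<subseteq> ground M"
  shows "matroid (restriction M S)"
  unfolding matroid_def restriction_simps
proof (intro conjI allI impI)
  show "finite S"
    by (rule finite_subset[OF S finite_ground[OF M]])
  show "indep M {}"
    by (rule indep_empty[OF M])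
  fix X Y
  show "indep M Y" if "(X \<subseteq> S \<and> indep M X) \<and> Y \<subseteq> X"
    using that indep_mono[OF M] by blast
  show "\<exists>x\<in>X - Y. insert x Y \<subseteq> S \<and> indep M (insert x Y)"
    if "(X \<subseteq> S \<and> indep M X) \<and> (Y \<subseteq> S \<and> indep M Y) \<and> card Y < card X"
    using that indep_augment[OF M, of X Y] by blast
qed auto

lemma rank_of_restriction: "X \<subseteq> S \<Longrightarrow> rank_of (restriction M S) X = rank_of M X"
  unfolding rank_of_def by (rule arg_cong[of _ _ Max]) auto

section \<open>Adding one point to a realization\<close>

text \<open>In the application \<open>insert p A\<close> and \<open>insert p B\<close> are circuits of the at most two
  subspaces through \<open>p\<close>; if there is only one subspace then \<open>A = B\<close>, and if there is none
  then \<open>A = B\<close> is a basis.  In each case the new vector ranges over an open part of the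
  intersection of the spans of \<open>A\<close> and \<open>B\<close>.\<close>

locale point_extension =
  fixes K :: "'a matroid_data" and p :: 'a and A B :: "'a set" and n :: nat
  assumes K: "matroid K" and p: "p \<in> ground K"
    and rank: "matroid_rank K = n" and rank_del: "rank_of K (ground K - {p}) = n"
    and A: "A \<subseteq> ground K - {p}" "indep K A" "\<not> indep K (insert p A)"
    and B: "B \<subseteq> ground K - {p}" "indep K B" "\<not> indep K (insert p B)"
    and small: "\<And>C. circuit K C \<Longrightarrow> p \<in> C \<Longrightarrow> card C \<le> n \<Longrightarrow> A \<subseteq> cl K C \<or> B \<subseteq> cl K C"
begin

abbreviation (input) G :: "'a set" where "G \<equiv> ground K - {p}"

abbreviation (input) X :: "('a \<times> nat \<Rightarrow> complex) set" where
  "X \<equiv> realization_space (restriction K G)"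

abbreviation (input) X' :: "('a \<times> nat \<Rightarrow> complex) set" where
  "X' \<equiv> realization_space K"

lemma finite_sub_ground: "S \<subseteq> ground K \<Longrightarrow> finite S"
  using finite_subset finite_ground[OF K] by blast

text \<open>By \<open>rank_del\<close> the restriction to the old points still has rank
  \<open>n\<close>, so old and new realizations live in the same C^n.\<close>

lemma mem_X_iff:
  "x \<in> X \<longleftrightarrow> x \<in> affine_space (G \<times> {..<n}) \<and>
     (\<forall>S\<subseteq>G. linearly_dependent_family n x S \<longleftrightarrow> \<not> indep K S)"
  unfolding realization_space_def matroid_rank_def dependent_set_def
  by (simp add: rank_of_restriction rank_del cong: conj_cong)

lemma mem_X'_iff:
  "x \<in> X' \<longleftrightarrow> x \<in> affine_space (ground K \<times> {..<n}) \<and>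
     (\<forall>S\<subseteq>ground K. linearly_dependent_family n x S \<longleftrightarrow> \<not> indep K S)"
  unfolding realization_space_def rank dependent_set_def by auto

text \<open>Sets avoiding \<open>p\<close> are controlled by the old realization, and every
  independent set through \<open>p\<close> extends to one of these bases; their determinants are the
  open conditions on the new vector.\<close>

definition bases_through_p :: "'a set set" where
  "bases_through_p = {T. indep K T \<and> card T = n \<and> p \<in> T}"

lemma finite_bases_through_p: "finite bases_through_p"
proof (rule finite_subset)
  show "bases_through_p \<subseteq> Pow (ground K)"
    unfolding bases_through_p_def using indep_subset_ground[OF K] by blast
qed (simp add: finite_ground[OF K])

lemma family_det_nonzero:
  assumes "x \<in> X" "T \<subseteq> G" "indep K T" "card T = n"
  shows "family_det n x T \<noteq> 0"
  using assms family_det_eq_0_iff[OF finite_sub_ground assms(4), of x] unfolding mem_X_iff by blast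

text \<open>Turns matroid closure into linear span: as \<open>Q\<close> is independent and
  \<open>insert a Q\<close> is not, a relation on the latter must involve the vector at
  \<open>a\<close>.\<close>

lemma in_span_realization:
  assumes "x \<in> X" "Q \<subseteq> G" "indep K Q" "a \<in> G" "a \<notin> Q \<Longrightarrow> \<not> indep K (insert a Q)"
  shows "in_span n x Q (\<lambda>i. x (a, i))"
proof (cases "a \<in> Q")
  case True
  then show ?thesis
    by (intro in_span_member finite_sub_ground) (use assms(2) in auto)
next
  case False
  have "insert a Q \<subseteq> G" using assms(2,4) by blast
  then have "linearly_dependent_family n x (insert a Q)" "\<not> linearly_dependent_family n x Q"
    using assms False unfolding mem_X_iff by blast+
  then show ?thesis
    using False assms(2) by (intro in_span_if_linearly_dependent_insert finite_sub_ground) auto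
qed

text \<open>Reduces all conditions on sets through \<open>p\<close> to two linear ones and finitely
  many open ones. In the converse direction independent sets are handled through bases containing
  them, dependent sets through circuits inside them.\<close>

lemma realization_extension_iff:
  assumes x: "restrict x (G \<times> {..<n}) \<in> X" and aff: "x \<in> affine_space (ground K \<times> {..<n})"
  shows "x \<in> X' \<longleftrightarrow> in_span n x A (\<lambda>i. x (p, i)) \<and> in_span n x B (\<lambda>i. x (p, i)) \<and>
    (\<forall>T\<in>bases_through_p. family_det n x T \<noteq> 0)"
    (is "_ \<longleftrightarrow> ?R")
proof
  have restr: "linearly_dependent_family n (restrict x (G \<times> {..<n})) S \<longleftrightarrow>
      linearly_dependent_family n x S" if "S \<subseteq> G" for S
    using that by (intro linearly_dependent_family_cong) auto
  have dep_G: "linearly_dependent_family n x S \<longleftrightarrow> \<not> indep K S" if "S \<subseteq> G" for S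
    using x that restr[OF that] unfolding mem_X_iff by blast
  {
    assume x': "x \<in> X'"
    have span: "in_span n x Q (\<lambda>i. x (p, i))"
      if "Q \<subseteq> G" "indep K Q" "\<not> indep K (insert p Q)" for Q
    proof (rule in_span_if_linearly_dependent_insert)
      have "insert p Q \<subseteq> ground K" using that(1) p by blast
      then show "linearly_dependent_family n x (insert p Q)"
        using x' that(3) unfolding mem_X'_iff by blast
      show "\<not> linearly_dependent_family n x Q"
        using dep_G that by blast
    qed (use that(1) finite_sub_ground[of Q] in auto)
    have "family_det n x T \<noteq> 0" if "T \<in> bases_through_p" for T
    proof -
      have T: "indep K T" "card T = n" "T \<subseteq> ground K"
        using that indep_subset_ground[OF K] unfolding bases_through_p_def by auto
      then have "\<not> linearly_dependent_family n x T"
        using x' unfolding mem_X'_iff by blast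
      then show ?thesis
        using family_det_eq_0_iff[OF indep_finite[OF K T(1)] T(2), of x] by blast
    qed
    then show ?R
      using span[OF A] span[OF B] by blast
  }
  assume R: ?R
  have "linearly_dependent_family n x S \<longleftrightarrow> \<not> indep K S" if S: "S \<subseteq> ground K" for S
  proof (cases "p \<in> S")
    case False
    then show ?thesis
      using dep_G S by blast
  next
    case pS: True
    show ?thesis
    proof (cases "indep K S")
      case True
      \<comment> \<open>Since \<open>p\<close> lies in \<open>S\<close>, the basis \<open>T\<close>
        belongs to \<open>bases_through_p\<close>.\<close>
      obtain T where T: "S \<subseteq> T" "indep K T" "card T = n"
        using indep_extend[OF K True S] rank unfolding matroid_rank_def by metis
      then have "family_det n x T \<noteq> 0"
        using R pS unfolding bases_through_p_def by blast
      then have "\<not> linearly_dependent_family n x T"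
        using family_det_eq_0_iff[OF indep_finite[OF K T(2)] T(3), of x] by blast
      then have "\<not> linearly_dependent_family n x S"
        using linearly_dependent_family_mono[OF _ T(1) indep_finite[OF K T(2)]] by blast
      then show ?thesis
        using True by blast
    next
      case False
      then have "dependent_set K S"
        using S unfolding dependent_set_def by blast
      then obtain C where C: "C \<subseteq> S" "circuit K C"
        using dependent_contains_circuit[OF K] by blast
      have CK: "C \<subseteq> ground K" "\<not> indep K C"
        using C(2) unfolding circuit_def dependent_set_def by auto
      have "linearly_dependent_family n x C"
      proof (cases "p \<in> C")
        case False
        then show ?thesis
          using dep_G CK by blast
      next
        case True
        let ?Q = "C - {p}"
        have Q: "?Q \<subseteq> G" "indep K ?Q" "rank_of K C = card ?Q"
          using CK circuit_delete[OF K C(2) True] by auto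
        have cardC: "card C = Suc (card ?Q)"
          using True finite_sub_ground[OF CK(1)] by (metis card_Suc_Diff1)
        \<comment> \<open>To be used with \<open>D = A\<close> or \<open>D = B\<close>: if
          \<open>D\<close> lies in the closure of \<open>C\<close>, the vectors of
          \<open>C - {p}\<close> span those of \<open>D\<close>, and so the vector at
          \<open>p\<close>.\<close>
        have span_of_cl: "in_span n x ?Q (\<lambda>i. x (p, i))"
          if "D \<subseteq> cl K C" "D \<subseteq> G" "in_span n x D (\<lambda>i. x (p, i))" for D
          using that(3)
        proof (rule in_span_trans)
          fix a assume a: "a \<in> D"
          have "in_span n (restrict x (G \<times> {..<n})) ?Q (\<lambda>i. restrict x (G \<times> {..<n}) (a, i))"
          proof (rule in_span_realization[OF x Q(1,2)])
            show "a \<in> G" using a that(2) by blast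
            show "\<not> indep K (insert a ?Q)" if "a \<notin> ?Q"
              using circuit_cl_dependent[OF K C(2) True _ that] a \<open>D \<subseteq> cl K C\<close> by blast
          qed
          then show "in_span n x ?Q (\<lambda>i. x (a, i))"
            by (rule iffD1[OF in_span_cong, rotated -1]) (use a that(2) Q(1) in auto)
        qed
        have "in_span n x ?Q (\<lambda>i. x (p, i))"
        proof (cases "card C \<le> n")
          case True
          then show ?thesis
            using small[OF C(2) \<open>p \<in> C\<close>] span_of_cl A(1) B(1) R by blast
        next
          \<comment> \<open>An independent set has at most \<open>n\<close> points, so here
            \<open>C - {p}\<close> has exactly \<open>n\<close> and spans all of C^n. Such a circuit
            imposes nothing on the new vector.\<close>
          case False
          have "card ?Q \<le> n"
            using card_le_rank_of[OF K Q(2,1)] rank_del by simp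
          then have "card ?Q = n"
            using False cardC by simp
          moreover have "family_det n x ?Q \<noteq> 0"
            using dep_G[OF Q(1)] Q(2) family_det_eq_0_iff[OF indep_finite[OF K Q(2)] \<open>card ?Q = n\<close>]
            by blast
          ultimately show ?thesis
            by (intro in_span_full indep_finite[OF K Q(2)])
        qed
        then have "linearly_dependent_family n x (insert p ?Q)"
          by (rule linearly_dependent_insertI) (use indep_finite[OF K Q(2)] in auto)
        then show ?thesis
          using True by (simp add: insert_absorb)
      qed
      then show ?thesis
        using linearly_dependent_family_mono[OF _ C(1) finite_sub_ground[OF S]] False by blast
    qed
  qed
  then show "x \<in> X'"
    unfolding mem_X'_iff using aff by blast
qed

text \<open>\<open>D\<close> is what a maximal independent subset of \<open>A \<union> B\<close>
  containing \<open>A\<close> adds to \<open>A\<close>. \<open>E\<close> completes it to a basis, so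
  that coordinates become quotients of n by n determinants.\<close>

lemma intersection_frame:
  obtains D E where "D \<subseteq> B - A" "indep K (A \<union> D)" "card A + card D = rank_of K (A \<union> B)"
    and "A \<union> D \<subseteq> E" "E \<subseteq> G" "indep K E" "card E = n"
proof -
  obtain J where J: "A \<subseteq> J" "J \<subseteq> A \<union> B" "indep K J" "card J = rank_of K (A \<union> B)"
    using indep_extend[OF K A(2), of "A \<union> B"] by blast
  have "J \<subseteq> G"
    using J(2) A(1) B(1) by blast
  then obtain E where E: "J \<subseteq> E" "E \<subseteq> G" "indep K E" "card E = n"
    using indep_extend[OF K J(3)] rank_del by metis
  have "A \<union> (J - A) = J"
    using J(1) by blast
  moreover have "card A + card (J - A) = card J"
    using J(1) indep_finite[OF K J(3)] by (metis card_Diff_subset card_mono finite_subset le_add_diff_inverse)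
  ultimately show thesis
    using that[of "J - A" E] J E by auto
qed

text \<open>The fibre coordinates are the coefficients \<open>c\<close> on \<open>B - D\<close>:
  \<open>ext\<close> combines the frame vectors \<open>v x b\<close> with them, and \<open>t\<close>
  reads them back as coordinates of the new vector over a basis containing \<open>B\<close>.
  Correcting by \<open>D\<close>-components alters coefficients on \<open>D\<close> only, so
  \<open>c\<close> survives.\<close>

lemma fractional_iso_step:
  assumes iso: "fractional_iso (G \<times> {..<n}) X {..<m} U" and U: "zariski_open {..<m} U"
    and k: "k + rank_of K (A \<union> B) = card A + card B"
  shows "\<exists>U'. zariski_open {..<m + k} U' \<and> fractional_iso (ground K \<times> {..<n}) X' {..<m + k} U'"
proof -
  obtain D E where D: "D \<subseteq> B - A" "indep K (A \<union> D)" "card A + card D = rank_of K (A \<union> B)"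
    and E: "A \<union> D \<subseteq> E" "E \<subseteq> G" "indep K E" "card E = n"
    using intersection_frame .
  \<comment> \<open>A second basis is needed: \<open>E\<close> serves to compute the frame vectors,
    whereas the fibre coordinates are taken with respect to \<open>B\<close>, which need not lie in
    \<open>E\<close>.\<close>
  obtain F where F: "B \<subseteq> F" "F \<subseteq> G" "indep K F" "card F = n"
    using indep_extend[OF K B(2,1)] rank_del by metis
  let ?S = "B - D"
  have fin: "finite A" "finite B" "finite D" "finite E" "finite F"
    using A(2) B(2) D(1) E(3) F(3) indep_finite[OF K] finite_subset[of D B] by auto
  have cardS: "card ?S = k"
    using k D(1,3) fin by (subst card_Diff_subset) (auto simp: subset_Diff_insert)
  define y where "y x b d = cramer_coeff n x E d (\<lambda>i. x (b, i))" for x :: "'a \<times> nat \<Rightarrow> complex" and b d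
  define v where "v x b i = x (b, i) - (\<Sum>d\<in>D. y x b d * x (d, i))"
    for x :: "'a \<times> nat \<Rightarrow> complex" and b i
  define ext where "ext x c = (\<lambda>(q, i)\<in>ground K \<times> {..<n}.
      if q = p then \<Sum>b\<in>?S. c b * v x b i else x (q, i))" for x c
  define t where "t b x = cramer_coeff n x F b (\<lambda>i. x (p, i))" for b and x :: "'a \<times> nat \<Rightarrow> complex"
  define f where "f x = (\<Prod>T\<in>bases_through_p. family_det n x T)" for x
  have detE: "family_det n x E \<noteq> 0" and detF: "family_det n x F \<noteq> 0" if "x \<in> X" for x
    using family_det_nonzero[OF that] E F by auto
  \<comment> \<open>\<open>A \<union> D\<close> already attains the rank of
    \<open>A \<union> B\<close>, so no further \<open>b\<close> can be added independently.\<close>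
  have B_span: "in_span n x (A \<union> D) (\<lambda>i. x (b, i))" if "x \<in> X" "b \<in> B" for x b
  proof (rule in_span_realization[OF that(1) _ D(2)])
    show "A \<union> D \<subseteq> G" "b \<in> G"
      using E that B(1) by auto
    show "\<not> indep K (insert b (A \<union> D))" if "b \<notin> A \<union> D"
    proof
      assume "indep K (insert b (A \<union> D))"
      moreover have "insert b (A \<union> D) \<subseteq> A \<union> B"
        using D(1) \<open>b \<in> B\<close> by blast
      ultimately have "card (insert b (A \<union> D)) \<le> card A + card D"
        unfolding D(3) by (rule card_le_rank_of[OF K])
      moreover have "card (A \<union> D) = card A + card D"
        using fin D(1) by (intro card_Un_disjoint) auto
      ultimately show False
        using that fin by simp
    qed
  qed
  \<comment> \<open>The coordinates over \<open>E\<close> of a vector in the span of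
    \<open>A \<union> D\<close> are its coordinates over \<open>A \<union> D\<close>; subtracting
    the \<open>D\<close>-part therefore leaves the \<open>A\<close>-part.\<close>
  have v_A: "in_span n x A (v x b)" if xb: "x \<in> X" "b \<in> B" for x b
  proof -
    obtain c where c: "\<And>i. i < n \<Longrightarrow> x (b, i) = (\<Sum>q\<in>A \<union> D. c q * x (q, i))"
      using B_span[OF xb] unfolding in_span_def by blast
    have y: "y x b d = c d" if "d \<in> D" for d
      unfolding y_def using cramer_coeff_subset[OF fin(4) E(4) detE[OF \<open>x \<in> X\<close>] E(1) c, of d] that E(1)
      by auto
    have "v x b i = (\<Sum>a\<in>A. c a * x (a, i))" if "i < n" for i
    proof -
      have "x (b, i) = (\<Sum>a\<in>A. c a * x (a, i)) + (\<Sum>d\<in>D. c d * x (d, i))"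
        unfolding c[OF that] using fin D(1) by (intro sum.union_disjoint) auto
      then show ?thesis
        unfolding v_def using y by simp
    qed
    then show ?thesis
      unfolding in_span_def by blast
  qed
  \<comment> \<open>Expansion over \<open>B\<close>: coefficient \<open>c q\<close> off
    \<open>D\<close>, and only corrections on \<open>D\<close>. It shows both membership in the span
    of \<open>B\<close> and that \<open>c\<close> is determined by the vector.\<close>
  have v_B: "(\<Sum>b\<in>?S. c b * v x b i) =
      (\<Sum>q\<in>B. (if q \<in> D then - (\<Sum>b\<in>?S. c b * y x b q) else c q) * x (q, i))" for x c i
  proof -
    have "(\<Sum>q\<in>B. (if q \<in> D then - (\<Sum>b\<in>?S. c b * y x b q) else c q) * x (q, i))
      = (\<Sum>q\<in>?S. (if q \<in> D then - (\<Sum>b\<in>?S. c b * y x b q) else c q) * x (q, i))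
      + (\<Sum>q\<in>D. (if q \<in> D then - (\<Sum>b\<in>?S. c b * y x b q) else c q) * x (q, i))"
      using fin D(1) by (intro sum.subset_diff) auto
    also have "\<dots> = (\<Sum>q\<in>?S. c q * x (q, i)) - (\<Sum>q\<in>D. (\<Sum>b\<in>?S. c b * y x b q) * x (q, i))"
      by (simp add: sum_negf)
    also have "(\<Sum>q\<in>D. (\<Sum>b\<in>?S. c b * y x b q) * x (q, i)) =
        (\<Sum>b\<in>?S. \<Sum>q\<in>D. c b * (y x b q * x (q, i)))"
      unfolding sum_distrib_right by (subst sum.swap) (simp add: mult.assoc)
    also have "(\<Sum>q\<in>?S. c q * x (q, i)) - \<dots> = (\<Sum>b\<in>?S. c b * v x b i)"
      unfolding v_def by (simp add: right_diff_distrib sum_subtractf sum_distrib_left)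
    finally show ?thesis ..
  qed
  have coeff_v: "cramer_coeff n x F b (\<lambda>i. \<Sum>b\<in>?S. c b * v x b i) = c b"
    if "x \<in> X" "b \<in> ?S" for x b c
    using cramer_coeff_subset[OF fin(5) F(4) detF[OF that(1)] F(1) v_B, of b c] that(2) F(1) by auto
  have ext_base: "restrict (ext x c) (G \<times> {..<n}) = x" if "x \<in> X" for x c
  proof (rule extensionalityI[of _ "G \<times> {..<n}"])
    show "x \<in> extensional (G \<times> {..<n})"
      using that unfolding mem_X_iff affine_space_def PiE_def by blast
  qed (auto simp: ext_def)
  have ext_p: "ext x c (p, i) = (\<Sum>b\<in>?S. c b * v x b i)" if "i < n" for x c i
    using that p by (simp add: ext_def)
  have ext_G: "ext x c (q, i) = x (q, i)" if "i < n" "q \<in> G" for x c q i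
    using that by (simp add: ext_def)
  have t_ext: "t b (ext x c) = c b" if "x \<in> X" "b \<in> ?S" for x c b
  proof -
    have "t b (ext x c) = cramer_coeff n x F b (\<lambda>i. \<Sum>b\<in>?S. c b * v x b i)"
      unfolding t_def using F(2) by (intro cramer_coeff_cong[OF fin(5) F(4)] ext_G ext_p) auto
    then show ?thesis
      using coeff_v[OF that] by simp
  qed
  \<comment> \<open>Only the spanning family is restricted. The vector at \<open>p\<close> must come
    from \<open>x\<close> itself, because the restriction carries no data there.\<close>
  have restr_p: "in_span n (restrict x (G \<times> {..<n})) Q (\<lambda>i. x (p, i)) \<longleftrightarrow> in_span n x Q (\<lambda>i. x (p, i))"
    if "Q \<subseteq> G" for Q x
    using that by (intro in_span_cong) auto
  have base: "restrict x (G \<times> {..<n}) \<in> X" if "x \<in> X'" for x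
  proof -
    have "linearly_dependent_family n (restrict x (G \<times> {..<n})) S \<longleftrightarrow> \<not> indep K S" if "S \<subseteq> G" for S
    proof -
      have "linearly_dependent_family n (restrict x (G \<times> {..<n})) S \<longleftrightarrow> linearly_dependent_family n x S"
        using that by (intro linearly_dependent_family_cong) auto
      then show ?thesis
        using \<open>x \<in> X'\<close> that unfolding mem_X'_iff by blast
    qed
    then show ?thesis
      unfolding mem_X_iff by (simp add: affine_space_def)
  qed
  have ext_t: "ext (restrict x (G \<times> {..<n})) (\<lambda>b\<in>?S. t b x) = x" if x: "x \<in> X'" for x
  proof -
    define r where "r = restrict x (G \<times> {..<n})"
    have r: "r \<in> X" and r_G: "\<And>q i. q \<in> G \<Longrightarrow> i < n \<Longrightarrow> r (q, i) = x (q, i)"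
      using base[OF x] by (auto simp: r_def)
    have aff: "x \<in> affine_space (ground K \<times> {..<n})"
      using x unfolding mem_X'_iff by blast
    have spanA: "in_span n r A (\<lambda>i. x (p, i))" and spanB: "in_span n r B (\<lambda>i. x (p, i))"
      using x realization_extension_iff[OF base[OF x] aff] restr_p[OF A(1)] restr_p[OF B(1)]
      unfolding r_def by blast+
    obtain s where s: "\<And>i. i < n \<Longrightarrow> x (p, i) = (\<Sum>b\<in>B. s b * r (b, i))"
      using spanB unfolding in_span_def by blast
    have ts: "t b x = s b" if "b \<in> ?S" for b
    proof -
      have "t b x = cramer_coeff n r F b (\<lambda>i. x (p, i))"
        unfolding t_def using F(2) by (intro cramer_coeff_cong[OF fin(5) F(4)] r_G[symmetric]) auto
      then show ?thesis
        using cramer_coeff_subset[OF fin(5) F(4) detF[OF r] F(1) s, of b] that F(1) by auto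
    qed
    \<comment> \<open>The frame spans the fibre: \<open>?u\<close> lies in the span of
      \<open>A\<close> because both terms do, and in the span of \<open>D\<close> because the
      coefficients on \<open>B - D\<close> cancel. Independence of \<open>A \<union> D\<close>
      forces it to be zero.\<close>
    let ?u = "\<lambda>i. x (p, i) - (\<Sum>b\<in>?S. s b * v r b i)"
    have "in_span n r A ?u"
      by (intro in_span_diff spanA in_span_combination) (use v_A[OF r] in auto)
    moreover have "in_span n r D ?u"
      unfolding in_span_def
    proof (intro exI allI impI)
      fix i assume i: "i < n"
      let ?e = "\<lambda>q. if q \<in> D then - (\<Sum>b\<in>?S. s b * y r b q) else s q"
      have "?u i = (\<Sum>q\<in>B. (s q - ?e q) * r (q, i))"
        unfolding v_B s[OF i] by (simp only: left_diff_distrib sum_subtractf)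
      also have "\<dots> = (\<Sum>q\<in>D. (s q - ?e q) * r (q, i))"
        using fin D(1) by (intro sum.mono_neutral_right) auto
      finally show "?u i = (\<Sum>q\<in>D. (s q - ?e q) * r (q, i))" .
    qed
    moreover have "\<not> linearly_dependent_family n r (A \<union> D)"
      using r D(2) E(1,2) unfolding mem_X_iff by blast
    ultimately have u0: "?u i = 0" if "i < n" for i
      using that fin D(1) by (intro in_span_disjoint_eq_0[where S = A and T = D and u = ?u]) auto
    show "ext (restrict x (G \<times> {..<n})) (\<lambda>b\<in>?S. t b x) = x"
      unfolding r_def[symmetric]
    proof (rule extensionalityI[of _ "ground K \<times> {..<n}"])
      show "x \<in> extensional (ground K \<times> {..<n})"
        using aff unfolding affine_space_def PiE_def by blast
      show "ext r (\<lambda>b\<in>?S. t b x) \<in> extensional (ground K \<times> {..<n})"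
        by (simp add: ext_def)
      fix z assume "z \<in> ground K \<times> {..<n}"
      then obtain q i where z: "z = (q, i)" "q \<in> ground K" "i < n" by auto
      show "ext r (\<lambda>b\<in>?S. t b x) z = x z"
      proof (cases "q = p")
        case True
        have "ext r (\<lambda>b\<in>?S. t b x) z = (\<Sum>b\<in>?S. s b * v r b i)"
          using ext_p[OF z(3)] ts True z(1) by simp
        then show ?thesis
          using u0[OF z(3)] True z(1) by simp
      next
        case False
        then show ?thesis
          using ext_G[of i q] r_G[of q i] z by simp
      qed
    qed
  qed
  have f: "f \<in> poly_funs (ground K \<times> {..<n})"
    unfolding f_def[abs_def]
  proof (intro poly_funs_prod family_det_poly)
    fix T assume "T \<in> bases_through_p"
    then have T: "indep K T" "card T = n" unfolding bases_through_p_def by auto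
    show "finite T" "card T = n" "T \<times> {..<n} \<subseteq> ground K \<times> {..<n}"
      using T indep_finite[OF K] indep_subset_ground[OF K] by auto
  qed
  \<comment> \<open>Both span conditions hold for every value of \<open>ext\<close>, so only the
    determinants of the bases through \<open>p\<close> remain.\<close>
  have X'_iff: "ext x c \<in> X' \<longleftrightarrow> f (ext x c) \<noteq> 0" if x: "x \<in> X" for x c
  proof -
    have aff: "ext x c \<in> affine_space (ground K \<times> {..<n})"
      by (simp add: ext_def affine_space_def)
    have "in_span n (ext x c) A (\<lambda>i. ext x c (p, i)) \<longleftrightarrow> in_span n x A (\<lambda>i. \<Sum>b\<in>?S. c b * v x b i)"
      using A(1) by (intro in_span_cong ext_G ext_p) auto
    moreover have "in_span n (ext x c) B (\<lambda>i. ext x c (p, i)) \<longleftrightarrow> in_span n x B (\<lambda>i. \<Sum>b\<in>?S. c b * v x b i)"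
      using B(1) by (intro in_span_cong ext_G ext_p) auto
    moreover have "in_span n x A (\<lambda>i. \<Sum>b\<in>?S. c b * v x b i)"
      by (intro in_span_combination) (use v_A[OF x] in auto)
    moreover have "in_span n x B (\<lambda>i. \<Sum>b\<in>?S. c b * v x b i)"
      unfolding in_span_def v_B by (intro exI allI impI) (rule refl)
    ultimately show ?thesis
      using realization_extension_iff[of "ext x c"] ext_base[OF x] x aff finite_bases_through_p
      unfolding f_def by simp
  qed
  show ?thesis
  proof (rule fractional_iso_extend[OF iso U _ cardS _ base _ ext_t ext_base t_ext f X'_iff])
    show "finite ?S" using fin by simp
    show "G \<times> {..<n} \<subseteq> ground K \<times> {..<n}" by auto
    show "fractional (ground K \<times> {..<n}) X' (t b)" for b
      unfolding t_def
    proof (rule fractional_cramer_coeff[OF fin(5) F(4)])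
      show "family_det n x F \<noteq> 0" if "x \<in> X'" for x
      proof -
        have "family_det n x F = family_det n (restrict x (G \<times> {..<n})) F"
          using F(2) by (intro family_det_cong[OF fin(5) F(4)]) auto
        then show ?thesis
          using detF[OF base[OF that]] by simp
      qed
    qed (use F(2) p in \<open>auto intro: fractional_coord\<close>)
  next
    fix Z :: "(nat \<Rightarrow> complex) set" and J \<xi> c z
    assume \<xi>X: "\<xi> ` Z \<subseteq> X" and \<xi>: "\<And>i. i \<in> G \<times> {..<n} \<Longrightarrow> fractional J Z (\<lambda>z. \<xi> z i)"
      and c: "\<And>b. b \<in> ?S \<Longrightarrow> fractional J Z (\<lambda>z. c z b)" and z: "z \<in> ground K \<times> {..<n}"
    obtain q i where z: "z = (q, i)" "q \<in> ground K" "i < n" using z by auto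
    have y_frac: "fractional J Z (\<lambda>z. y (\<xi> z) b d)" if "b \<in> B" for b d
      unfolding y_def
    proof (rule fractional_cramer_coeff[OF fin(4) E(4)])
      show "family_det n (\<xi> z) E \<noteq> 0" if "z \<in> Z" for z
        using detE \<xi>X that by blast
    qed (use \<xi> E(2) B(1) that in auto)
    show "fractional J Z (\<lambda>z'. ext (\<xi> z') (c z') z)"
    proof (cases "q = p")
      case True
      have "fractional J Z (\<lambda>z. \<Sum>b\<in>?S. c z b * v (\<xi> z) b i)"
        unfolding v_def
      proof (intro fractional_sum fractional_mult c fractional_diff y_frac)
        show "fractional J Z (\<lambda>z. \<xi> z (b, i))" if "b \<in> ?S" for b
          using that B(1) z by (intro \<xi>) auto
        show "fractional J Z (\<lambda>z. \<xi> z (d, i))" if "d \<in> D" for d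
          using that D(1) B(1) z by (intro \<xi>) auto
      qed auto
      then show ?thesis
        using ext_p[OF z(3)] True z(1) by simp
    next
      case False
      then show ?thesis
        using ext_G[OF z(3), of q] \<xi>[of "(q, i)"] z by simp
    qed
  qed
qed

end

section \<open>Subspaces through the new point\<close>

lemma same_closure_class:
  assumes "l \<in> subspaces K" "C \<in> l"
  shows "C \<in> small_circuits K" "l = {C' \<in> small_circuits K. cl K C' = cl K C}"
  using assms unfolding subspaces_def quotient_def same_closure_def by auto

lemma finite_subspaces_through:
  assumes "matroid K"
  shows "finite (subspaces_through K p)"
proof -
  have "small_circuits K \<subseteq> Pow (ground K)"
    unfolding small_circuits_def circuit_def dependent_set_def by blast
  then have "finite (small_circuits K)"
    using finite_ground[OF assms] finite_subset by auto
  then have "finite (subspaces K)"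
    unfolding subspaces_def by (rule finite_quotient) (auto simp: same_closure_def)
  then show ?thesis
    unfolding subspaces_through_def by simp
qed

lemma small_circuit_subspace:
  assumes "C \<in> small_circuits K" "p \<in> C"
  obtains l where "l \<in> subspaces_through K p" "C \<in> l"
proof
  let ?l = "same_closure K `` {C}"
  show C: "C \<in> ?l"
    using assms(1) by (simp add: same_closure_def)
  then show "?l \<in> subspaces_through K p"
    using assms unfolding subspaces_through_def subspaces_def points_def
    by (auto intro: quotientI)
qed

text \<open>All circuits of a class have the same closure, and closure preserves rank; this makes
  the description in \<open>subspace_rank\<close> well defined, with its value read off from a
  circuit through \<open>p\<close>.\<close>

lemma subspace_through_circuit:
  assumes K: "matroid K" and l: "l \<in> subspaces_through K p"
  obtains C where "circuit K C" "p \<in> C" "C \<in> l" "subspace_rank K l = card (C - {p})"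
    and "points l \<subseteq> cl K C"
proof -
  have sub: "l \<in> subspaces K"
    using l unfolding subspaces_through_def by blast
  obtain C where C: "C \<in> l" "p \<in> C"
    using l unfolding subspaces_through_def points_def by blast
  note C_class = same_closure_class[OF sub C(1)]
  have circ: "circuit K C"
    using C_class(1) unfolding small_circuits_def by blast
  have ground: "C' \<subseteq> ground K" if "C' \<in> small_circuits K" for C'
    using that unfolding small_circuits_def circuit_def dependent_set_def by blast
  have rank: "rank_of K C' = card (C - {p})" if "C' \<in> l" for C'
  proof -
    have "C' \<in> small_circuits K" "cl K C' = cl K C"
      using that C_class(2) by auto
    then have "rank_of K C' = rank_of K C"
      using rank_of_cl[OF K ground] C_class(1) by metis
    then show ?thesis
      using circuit_delete(2)[OF K circ C(2)] by simp
  qed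
  have "subspace_rank K l = card (C - {p})"
    unfolding subspace_rank_def using rank C(1) by (intro the_equality) auto
  moreover have "points l \<subseteq> cl K C"
  proof
    fix z assume "z \<in> points l"
    then obtain C' where "C' \<in> l" "z \<in> C'"
      unfolding points_def by blast
    then show "z \<in> cl K C"
      using C_class(2) cl_superset[OF ground, of C'] by auto
  qed
  ultimately show thesis
    using that circ C by blast
qed

text \<open>Equality of closures supplies the locale condition \<open>small\<close>, since each
  \<open>Ci\<close> lies in its own closure. The two circuits may coincide, which covers the case of
  a single subspace.\<close>

lemma point_extension_circuits:
  assumes K: "matroid K" "matroid_rank K = n" "rank_of K (ground K - {p}) = n"
    and C1: "circuit K C1" "p \<in> C1" and C2: "circuit K C2" "p \<in> C2"
    and small: "\<And>C. C \<in> small_circuits K \<Longrightarrow> p \<in> C \<Longrightarrow> cl K C = cl K C1 \<or> cl K C = cl K C2"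
  shows "point_extension K p (C1 - {p}) (C2 - {p}) n"
proof
  have ground: "C \<subseteq> ground K" "\<not> indep K C" if "circuit K C" for C
    using that unfolding circuit_def dependent_set_def by auto
  have ins: "insert p (C1 - {p}) = C1" "insert p (C2 - {p}) = C2"
    using C1 C2 by auto
  show "\<not> indep K (insert p (C1 - {p}))" "\<not> indep K (insert p (C2 - {p}))"
    unfolding ins using ground C1(1) C2(1) by auto
  show "C1 - {p} \<subseteq> ground K - {p}" "C2 - {p} \<subseteq> ground K - {p}" "p \<in> ground K"
    using ground(1)[OF C1(1)] ground(1)[OF C2(1)] C1(2) by auto
  show "indep K (C1 - {p})" "indep K (C2 - {p})"
    using circuit_delete(1)[OF K(1)] C1 C2 by auto
  show "C1 - {p} \<subseteq> cl K C \<or> C2 - {p} \<subseteq> cl K C" if "circuit K C" "p \<in> C" "card C \<le> n" for C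
  proof -
    have "C \<in> small_circuits K"
      using that K(2) unfolding small_circuits_def by simp
    then show ?thesis
      using small[OF _ that(2)] cl_superset[OF ground(1)[OF C1(1)]] cl_superset[OF ground(1)[OF C2(1)]]
      by auto
  qed
qed (use K in auto)

text \<open>\<open>tau_tilde\<close> freed from the ordering. The rank \<open>n\<close> is a
  separate argument because, for the first few points, the initial matroid has rank smaller than
  that of the whole matroid.\<close>

definition new_point_dim :: "'a matroid_data \<Rightarrow> 'a \<Rightarrow> nat \<Rightarrow> int" where
  "new_point_dim K p n = (let N = subspaces_through K p in
     if card N \<le> 1 then (\<Sum>l\<in>N. int (subspace_rank K l)) - int n * (int (card N) - 1)
     else (\<Sum>l\<in>N. int (subspace_rank K l)) - int (rank_of K (\<Union>l\<in>N. points l)))"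

lemma tau_tilde_eq: "tau_tilde M w i = new_point_dim (initial M w i) (w i) (matroid_rank M)"
  unfolding tau_tilde_def tau_def new_subspaces_def new_point_dim_def Let_def ..

text \<open>Both branches of \<open>tau_tilde\<close> measure one intersection: when
  \<open>A = B\<close> the rank formula collapses to \<open>card A\<close>, which is
  \<open>n\<close> without subspaces and the rank of the subspace if there is just one.\<close>

lemma new_point_extension:
  assumes K: "matroid K" "matroid_rank K = n" "rank_of K (ground K - {p}) = n" and p: "p \<in> ground K"
    and two: "card (subspaces_through K p) \<le> 2"
  obtains A B k where "point_extension K p A B n" "k + rank_of K (A \<union> B) = card A + card B"
    and "int k = new_point_dim K p n"
proof -
  let ?N = "subspaces_through K p"
  have fin: "finite ?N"
    by (rule finite_subspaces_through[OF K(1)])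
  consider "?N = {}" | l where "?N = {l}" | l1 l2 where "?N = {l1, l2}" "l1 \<noteq> l2"
  proof -
    have "card ?N = 0 \<or> card ?N = 1 \<or> card ?N = 2"
      using two by auto
    then show thesis
      using that fin by (metis card_0_eq card_1_singletonE card_2_iff)
  qed
  then show thesis
  proof cases
    case 1
    obtain A where A: "A \<subseteq> ground K - {p}" "indep K A" "card A = n"
      using rank_of_attained[OF K(1)] K(3) by metis
    have "\<not> indep K (insert p A)"
    proof
      assume "indep K (insert p A)"
      then have "card (insert p A) \<le> n"
        using card_le_rank_of[OF K(1) _ indep_subset_ground[OF K(1)]] K(2)
        unfolding matroid_rank_def by simp
      moreover have "card (insert p A) = Suc n"
        using A indep_finite[OF K(1) A(2)] by (metis Diff_iff card_insert_disjoint insertI1 subsetD)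
      ultimately show False by simp
    qed
    moreover have "A \<subseteq> cl K C" if C: "circuit K C" "p \<in> C" "card C \<le> n" for C
    proof -
      have "C \<in> small_circuits K"
        using C K(2) unfolding small_circuits_def by simp
      then show ?thesis
        using small_circuit_subspace[OF _ C(2)] 1 by blast
    qed
    ultimately have "point_extension K p A A n"
      using A K p by unfold_locales auto
    moreover have "n + rank_of K (A \<union> A) = card A + card A"
      using rank_of_indep[OF K(1) A(2)] A(3) by simp
    moreover have "int n = new_point_dim K p n"
      by (simp add: new_point_dim_def 1)
    ultimately show thesis
      using that by blast
  next
    case (2 l)
    then obtain C where C: "circuit K C" "p \<in> C" "C \<in> l" "subspace_rank K l = card (C - {p})"
      using subspace_through_circuit[OF K(1), of l p] by blast
    have l: "l \<in> subspaces K"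
      using 2 unfolding subspaces_through_def by blast
    have "point_extension K p (C - {p}) (C - {p}) n"
    proof (rule point_extension_circuits[OF K C(1,2) C(1,2)])
      fix C' assume C': "C' \<in> small_circuits K" "p \<in> C'"
      then have "C' \<in> l"
        using small_circuit_subspace[OF C'] 2 by blast
      then show "cl K C' = cl K C \<or> cl K C' = cl K C"
        using same_closure_class(2)[OF l C(3)] by auto
    qed
    moreover have "card (C - {p}) + rank_of K ((C - {p}) \<union> (C - {p})) = card (C - {p}) + card (C - {p})"
      using rank_of_indep[OF K(1) circuit_delete(1)[OF K(1) C(1,2)]] by simp
    moreover have "int (card (C - {p})) = new_point_dim K p n"
      by (simp add: new_point_dim_def 2 C(4))
    ultimately show thesis
      using that by blast
  next
    case (3 l1 l2)
    obtain C1 where C1: "circuit K C1" "p \<in> C1" "C1 \<in> l1" "subspace_rank K l1 = card (C1 - {p})"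
      "points l1 \<subseteq> cl K C1"
      using subspace_through_circuit[OF K(1), of l1 p] 3 by blast
    obtain C2 where C2: "circuit K C2" "p \<in> C2" "C2 \<in> l2" "subspace_rank K l2 = card (C2 - {p})"
      "points l2 \<subseteq> cl K C2"
      using subspace_through_circuit[OF K(1), of l2 p] 3 by blast
    have l: "l1 \<in> subspaces K" "l2 \<in> subspaces K"
      using 3 unfolding subspaces_through_def by blast+
    let ?A = "C1 - {p}" and ?B = "C2 - {p}"
    have ext: "point_extension K p ?A ?B n"
    proof (rule point_extension_circuits[OF K C1(1,2) C2(1,2)])
      fix C' assume C': "C' \<in> small_circuits K" "p \<in> C'"
      then have "C' \<in> l1 \<or> C' \<in> l2"
        using small_circuit_subspace[OF C'] 3 by blast
      then show "cl K C' = cl K C1 \<or> cl K C' = cl K C2"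
        using same_closure_class(2)[OF l(1) C1(3)] same_closure_class(2)[OF l(2) C2(3)] by auto
    qed
    have ind: "indep K ?A" "indep K ?B"
      using circuit_delete(1)[OF K(1)] C1(1,2) C2(1,2) by auto
    have sub: "?A \<union> ?B \<subseteq> points l1 \<union> points l2"
      using C1(3) C2(3) unfolding points_def by blast
    \<comment> \<open>Every point of \<open>li\<close> is in the closure of \<open>Ci\<close>, which
      \<open>Ci - {p}\<close> generates; so the union of the two subspaces has the rank of
      \<open>?A \<union> ?B\<close>.\<close>
    have "rank_of K ((?A \<union> ?B) \<union> (points l1 \<union> points l2)) = rank_of K (?A \<union> ?B)"
    proof (rule rank_of_union_absorb[OF K(1)])
      show "finite (points l1 \<union> points l2)"
        by (rule finite_subset[OF _ finite_ground[OF K(1)]]) (use C1(5) C2(5) cl_ground[of K] in blast)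
      fix z assume "z \<in> points l1 \<union> points l2"
      then have "z \<in> cl K C1 \<or> z \<in> cl K C2"
        using C1(5) C2(5) by blast
      then show "z \<in> ?A \<union> ?B \<or> (\<exists>B\<subseteq>?A \<union> ?B. indep K B \<and> \<not> indep K (insert z B))"
        using circuit_cl_dependent[OF K(1) C1(1,2), of z] circuit_cl_dependent[OF K(1) C2(1,2), of z] ind
        by (metis Un_iff Un_upper1 Un_upper2)
    qed
    then have rank: "rank_of K (points l1 \<union> points l2) = rank_of K (?A \<union> ?B)"
      using sub by (simp add: Un_absorb1)
    \<comment> \<open>Ensures that the natural-number difference defining \<open>k\<close> does not
      truncate.\<close>
    have "rank_of K (?A \<union> ?B) \<le> card ?A + card ?B"
    proof -
      obtain J where J: "J \<subseteq> ?A \<union> ?B" "card J = rank_of K (?A \<union> ?B)"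
        using rank_of_attained[OF K(1)] by metis
      have "card J \<le> card (?A \<union> ?B)"
        using J(1) by (intro card_mono finite_UnI indep_finite[OF K(1)] ind)
      then show ?thesis
        using J(2) card_Un_le[of ?A ?B] by simp
    qed
    then have k: "(card ?A + card ?B - rank_of K (?A \<union> ?B)) + rank_of K (?A \<union> ?B) = card ?A + card ?B"
      by simp
    have "int (card ?A + card ?B - rank_of K (?A \<union> ?B)) = new_point_dim K p n"
      using \<open>rank_of K (?A \<union> ?B) \<le> card ?A + card ?B\<close> 3(2)
      by (simp add: new_point_dim_def 3(1) C1(4) C2(4) rank of_nat_diff)
    then show thesis
      using that[OF ext k] by blast
  qed
qed

section \<open>The induction along the ordering\<close>

lemma restriction_restriction: "T \<subseteq> S \<Longrightarrow> restriction (restriction M S) T = restriction M T"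
  unfolding restriction_def by auto

lemma restriction_ground: "matroid M \<Longrightarrow> restriction M (ground M) = M"
  using indep_subset_ground[of M] unfolding restriction_def
  by (intro matroid_data.equality) (auto simp: fun_eq_iff)

text \<open>All subsets of \<open>E\<close> are independent and inherit linear independence from
  \<open>E\<close>, so the realizations are exactly the invertible n by n matrices.\<close>

lemma realization_space_free:
  assumes M: "matroid M" and E: "indep M E" "card E = n"
  shows "realization_space (restriction M E) =
    {x \<in> affine_space (E \<times> {..<n}). family_det n x E \<noteq> 0}"
proof -
  have fin: "finite E" by (rule indep_finite[OF M E(1)])
  have rank: "matroid_rank (restriction M E) = n"
    unfolding matroid_rank_def
    by (simp add: rank_of_restriction rank_of_indep[OF M E(1)] E(2))
  have dep: "\<not> dependent_set (restriction M E) S" if "S \<subseteq> E" for S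
    using that indep_mono[OF M E(1)] unfolding dependent_set_def by simp
  have "(\<forall>S\<subseteq>E. linearly_dependent_family n x S \<longleftrightarrow> dependent_set (restriction M E) S) \<longleftrightarrow>
      family_det n x E \<noteq> 0" for x
    using dep linearly_dependent_family_mono[of n x _ E] family_det_eq_0_iff[OF fin E(2), of x] fin
    by blast
  then show ?thesis
    unfolding realization_space_def rank by simp
qed

text \<open>An independent ground set has no circuits. Each of the first \<open>n\<close> points
  thus contributes \<open>n\<close>, which adds up to the \<open>n * n\<close> entries of an
  invertible matrix.\<close>

lemma new_point_dim_free:
  assumes M: "matroid M" and E: "indep M E"
  shows "new_point_dim (restriction M E) p n = int n"
proof -
  have "small_circuits (restriction M E) = {}"
    unfolding small_circuits_def circuit_def dependent_set_def using indep_mono[OF M E] by auto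
  then have "subspaces_through (restriction M E) p = {}"
    unfolding subspaces_through_def subspaces_def quotient_def by simp
  then show ?thesis
    by (simp add: new_point_dim_def)
qed

theorem theorem4p15:
  fixes M :: "'a matroid_data" and w :: "nat \<Rightarrow> 'a" and n d :: nat
  assumes "matroid M"
    and "matroid_rank M = n"
    and "card (ground M) = d"
    and "inductively_connected M"
    and "point_ordering M w"
    and "basis M (w ` {1..n})"
    and "\<forall>i. n < i \<and> i \<le> d \<longrightarrow> card (new_subspaces M w i) \<le> 2"
  shows "\<exists>(m :: nat) (U :: (nat \<Rightarrow> complex) set).
           int m = (\<Sum>i=1..d. tau_tilde M w i) \<and>
           zariski_open {..<m} U \<and>
           isomorphic_varieties (ground M \<times> {..<n}) (realization_space M) {..<m} U"
proof -
  note M = assms(1)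
  have inj: "inj_on w {1..d}" and surj: "w ` {1..d} = ground M"
    using assms(3,5) unfolding point_ordering_def bij_betw_def by auto
  obtain J where "J \<subseteq> ground M" "card J = n"
    using rank_of_attained[OF M, of "ground M"] assms(2) unfolding matroid_rank_def by metis
  then have nd: "n \<le> d"
    using card_mono[OF finite_ground[OF M]] assms(3) by blast
  have E: "indep M (w ` {1..n})"
    using assms(6) unfolding basis_def by blast
  have "inj_on w {1..n}"
    using inj by (rule inj_on_subset) (use nd in auto)
  then have card_E: "card (w ` {1..n}) = n"
    by (simp add: card_image)
  have ground: "w ` {1..i} \<subseteq> ground M" if "i \<le> d" for i
    unfolding surj[symmetric] using that by (intro image_mono) auto
  have rank: "rank_of M (w ` {1..i}) = n" if "n \<le> i" "i \<le> d" for i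
  proof (rule antisym)
    show "rank_of M (w ` {1..i}) \<le> n"
      using rank_of_mono[OF M ground[OF that(2)]] assms(2) unfolding matroid_rank_def by simp
    show "n \<le> rank_of M (w ` {1..i})"
      using card_le_rank_of[OF M E, of "w ` {1..i}"] card_E that(1) by (simp add: image_mono)
  qed
  \<comment> \<open>The induction starts at \<open>n\<close>: from there on the initial matroids
    have rank \<open>n\<close>, so their realization spaces all use vectors of C^n. Shorter initial
    segments would be realized in smaller spaces.\<close>
  have "\<exists>m U. int m = (\<Sum>j=1..i. tau_tilde M w j) \<and> zariski_open {..<m} U \<and>
      fractional_iso (w ` {1..i} \<times> {..<n}) (realization_space (initial M w i)) {..<m} U"
    if "n \<le> i" "i \<le> d" for i
    using that
  proof (induction i rule: nat_induct_at_least)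
    case base
    have fin: "finite (w ` {1..n})" by simp
    have "\<exists>U. zariski_open {..<n * n} U \<and> fractional_iso (w ` {1..n} \<times> {..<n})
        {x \<in> affine_space (w ` {1..n} \<times> {..<n}). family_det n x (w ` {1..n}) \<noteq> 0} {..<n * n} U"
      using fin card_E
      by (intro fractional_iso_nonvanishing family_det_poly) (auto simp: card_cartesian_product)
    moreover have "tau_tilde M w j = int n" if "j \<in> {1..n}" for j
    proof -
      have "w ` {1..j} \<subseteq> w ` {1..n}"
        using that by (intro image_mono) auto
      then have "indep M (w ` {1..j})"
        by (rule indep_mono[OF M E])
      then show ?thesis
        unfolding tau_tilde_eq initial_def assms(2) by (rule new_point_dim_free[OF M])
    qed
    then have "int (n * n) = (\<Sum>j=1..n. tau_tilde M w j)"
      by simp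
    ultimately show ?case
      unfolding initial_def realization_space_free[OF M E card_E] by blast
  next
    case (Suc i)
    obtain m U where m: "int m = (\<Sum>j=1..i. tau_tilde M w j)" and U: "zariski_open {..<m} U"
      and iso: "fractional_iso (w ` {1..i} \<times> {..<n}) (realization_space (initial M w i)) {..<m} U"
      using Suc by auto
    let ?K = "initial M w (Suc i)" and ?p = "w (Suc i)"
    have K: "matroid ?K"
      unfolding initial_def using matroid_restriction[OF M ground[OF Suc.prems]] .
    have gK: "ground ?K = w ` {1..Suc i}"
      by (simp add: initial_def)
    have "{1..Suc i} - {Suc i} \<subseteq> {1..d}" "{Suc i} \<subseteq> {1..d}"
      using Suc.prems by auto
    from inj_on_image_set_diff[OF inj this]
    have "w ` {1..Suc i} - {?p} = w ` ({1..Suc i} - {Suc i})"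
      by simp
    also have "{1..Suc i} - {Suc i} = {1..i}"
      by auto
    finally have G: "ground ?K - {?p} = w ` {1..i}"
      unfolding gK .
    have sub: "w ` {1..i} \<subseteq> w ` {1..Suc i}"
      by (intro image_mono) auto
    have "matroid_rank ?K = n"
      unfolding matroid_rank_def gK unfolding initial_def
      using rank[of "Suc i"] Suc by (simp add: rank_of_restriction)
    moreover have "rank_of ?K (ground ?K - {?p}) = n"
      unfolding G unfolding initial_def using rank[of i] Suc sub by (simp add: rank_of_restriction)
    moreover have "?p \<in> ground ?K"
      unfolding gK by simp
    moreover have "card (subspaces_through ?K ?p) \<le> 2"
      using assms(7) Suc unfolding new_subspaces_def by simp
    ultimately obtain A B k where ext: "point_extension ?K ?p A B n"
      and k: "k + rank_of ?K (A \<union> B) = card A + card B" "int k = new_point_dim ?K ?p n"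
      using new_point_extension[OF K] by blast
    have restr: "restriction ?K (ground ?K - {?p}) = initial M w i"
      unfolding G unfolding initial_def by (rule restriction_restriction[OF sub])
    have "fractional_iso ((ground ?K - {?p}) \<times> {..<n})
        (realization_space (restriction ?K (ground ?K - {?p}))) {..<m} U"
      unfolding restr unfolding G by (rule iso)
    from point_extension.fractional_iso_step[OF ext this U k(1)]
    have "\<exists>U'. zariski_open {..<m + k} U' \<and>
        fractional_iso (w ` {1..Suc i} \<times> {..<n}) (realization_space ?K) {..<m + k} U'"
      unfolding gK .
    moreover have "int (m + k) = (\<Sum>j=1..Suc i. tau_tilde M w j)"
      using m k(2) assms(2) by (simp add: tau_tilde_eq)
    ultimately show ?case
      by blast
  qed
  from this[OF nd order_refl] obtain m U where "int m = (\<Sum>j=1..d. tau_tilde M w j)"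
    and U: "zariski_open {..<m} U"
    and iso: "fractional_iso (ground M \<times> {..<n}) (realization_space M) {..<m} U"
    unfolding initial_def surj restriction_ground[OF M] by blast
  moreover have "isomorphic_varieties (ground M \<times> {..<n}) (realization_space M) {..<m} U"
    using iso
  proof (rule fractional_iso_imp_isomorphic)
    show "realization_space M \<subseteq> affine_space (ground M \<times> {..<n})"
      unfolding realization_space_def assms(2) by blast
    show "U \<subseteq> affine_space {..<m}"
      using U unfolding zariski_open_def by blast
  qed
  ultimately show ?thesis
    by blast
qed

end
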